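(* Let $G$ be a finite simple planar graph with girth $g(G)\geq 7$ and maximum degree $\Delta(G)\geq 10$. Then $G$ admits a $2$-distance $(\Delta(G)+2)$-coloring.
   Context: For a finite simple graph $G$, $\Delta(G)$ is its maximum degree and $g(G)$ is its girth, i.e. the length of a shortest cycle. A $2$-distance $k$-coloring of $G$ is a map $\phi:V(G)\to\{1,\dots,k\}$ such that $\phi(x)\neq\phi(y)$ for any two distinct vertices $x,y$ at distance at most $2$ in $G$. *)

theory Defs
  imports "HOL-Analysis.Analysis" "Graph_Theory.Graph_Theory"
begin

text \<open>
  Finite simple graphs are the locale \<open>graph\<close>: finite digraphs without loops and parallel
  arcs whose arc relation is symmetric. Each undirected edge is thus represented by two opposite
  arcs, so the degree of a vertex is its \<open>out_degree\<close>.
\<close>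

definition edges :: "('a, 'b) pre_digraph \<Rightarrow> 'a set set" where
  "edges G = (\<lambda>(u, v). {u, v}) ` arcs_ends G"

text \<open>The \<open>insert 0\<close> only matters for the graph without vertices.\<close>

definition max_degree :: "('a, 'b) pre_digraph \<Rightarrow> nat" where
  "max_degree G = Max (insert 0 (out_degree G ` verts G))"

text \<open>
  In a symmetric digraph, \<open>pre_digraph.cycle\<close> also holds of an arc followed by its
  reverse; the undirected cycles are those of length at least 3. The girth of a forest is \<open>\<infinity>\<close>.
\<close>

definition girth :: "('a, 'b) pre_digraph \<Rightarrow> enat" where
  "girth G = (INF p \<in> {p. pre_digraph.cycle G p \<and> 3 \<le> length p}. enat (length p))"

text \<open>
  The distance of two vertices is the least number of arcs on a walk between them, and \<open>\<infinity>\<close>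
  if there is no such walk.
\<close>

definition graph_distance :: "('a, 'b) pre_digraph \<Rightarrow> 'a \<Rightarrow> 'a \<Rightarrow> ereal" where
  "graph_distance G u v = wf_digraph.\<mu> G (\<lambda>_. 1) u v"

definition two_distance_coloring :: "('a, 'b) pre_digraph \<Rightarrow> nat \<Rightarrow> ('a \<Rightarrow> nat) \<Rightarrow> bool" where
  "two_distance_coloring G k \<phi> \<longleftrightarrow>
     \<phi> ` verts G \<subseteq> {1..k} \<and>
     (\<forall>x \<in> verts G. \<forall>y \<in> verts G. x \<noteq> y \<and> graph_distance G x y \<le> 2 \<longrightarrow> \<phi> x \<noteq> \<phi> y)"

text \<open>
  A drawing in the plane \<open>complex\<close>: distinct vertices are distinct points, an edge is a
  simple arc joining its two ends and meeting no other vertex, and two distinct edges meet at most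
  in common ends. The direction in which the arc of an edge is traversed is irrelevant.
\<close>

definition plane_drawing ::
  "('a, 'b) pre_digraph \<Rightarrow> ('a \<Rightarrow> complex) \<Rightarrow> ('a set \<Rightarrow> real \<Rightarrow> complex) \<Rightarrow> bool" where
  "plane_drawing G pos crv \<longleftrightarrow>
     inj_on pos (verts G) \<and>
     (\<forall>e \<in> edges G. arc (crv e) \<and>
        {pathstart (crv e), pathfinish (crv e)} = pos ` e \<and>
        path_image (crv e) \<inter> pos ` verts G = pos ` e) \<and>
     (\<forall>e \<in> edges G. \<forall>f \<in> edges G. e \<noteq> f \<longrightarrow>
        path_image (crv e) \<inter> path_image (crv f) = pos ` (e \<inter> f))"

definition planar :: "('a, 'b) pre_digraph \<Rightarrow> bool" where
  "planar G \<longleftrightarrow> (\<exists>pos crv. plane_drawing G pos crv)"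

end

theory Submission
  imports Defs
begin

text \<open>
  Colour the vertex subsets of the graph one after the other, and suppose that \<open>X\<close> is a
  minimal subset whose induced subgraph has no colouring with \<open>k + 2\<close> colours, where
  \<open>k \<ge> 10\<close> is the maximum degree. The average degree in \<open>X\<close> is then at least \<open>14/5\<close>
  (\<open>critical_degree_sum\<close>) because minimality forbids too many vertices of degree 2, but
  it is less than \<open>14/5\<close> (\<open>sparse_subgraphs\<close>) because \<open>X\<close> is drawn in the plane
  and has no cycle shorter than 7.

  The upper bound is Euler's formula. Starting from a spanning forest, whose drawing does not
  separate the plane (\<open>forest_one_face\<close>), each further edge closes a Jordan curve and cuts one
  face in two (\<open>faces_insert_closing_edge\<close>). Janiszewski's theorem is what makes this work
  for arbitrary arcs. An edge touches at most two faces, and the edges touched by a face contain a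
  cycle, hence number at least 7 (\<open>touching_cyclic\<close>). Counting incidences between edges
  and faces gives \<open>5 |E| + 14 \<le> 7 |V|\<close> when there are two or more faces
  (\<open>girth_edge_bound\<close>); a graph with only one face is a forest.

  The lower bound is a discharging argument. Give a vertex of degree \<open>d\<close> the charge
  \<open>5 d - 14\<close>, so that vertices of degree 2 lack 4 and those of degree \<open>k\<close> have a large
  surplus. Vertices send charge to their neighbours of degree 2 or 3 in such a way that nobody ends
  below 0. Two facts about minimal uncolourable sets make this possible. If a vertex of degree 2 and
  one of its neighbours could be uncoloured and coloured again, the set would be colourable, so that
  neighbour has further neighbours of large degree (\<open>two_vertex_weight\<close>), which support it.
  And a vertex of degree \<open>k\<close> cannot be surrounded only by needy neighbours, namely vertices of
  degree 2 whose other neighbour is poor as well (\<open>stiff_nonempty\<close>, \<open>chain_hub\<close>):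
  such a neighbourhood can be recoloured as a whole (\<open>hub_recolour\<close>), since no cycle shorter
  than 7 connects its branches. This limits what a vertex of degree \<open>k\<close> has to give away
  (\<open>hub_sends\<close>).
\<close>

text \<open>From here on, \<open>connected\<close> refers to topological spaces.\<close>

hide_const (open) Digraph_Component.connected

section \<open>Forests\<close>

definition linked :: "'a set set \<Rightarrow> ('a \<times> 'a) set" where
  "linked A = {(u, v). {u, v} \<in> A}"

text \<open>
  Expressing cycles through reachability avoids surgery on lists of vertices when edges are added
  or deleted; \<open>cyclic_edges_card\<close> recovers an actual cycle.
\<close>
definition acyclic_edges :: "'a set set \<Rightarrow> bool" where
  "acyclic_edges A \<longleftrightarrow> (\<forall>u v. {u, v} \<in> A \<longrightarrow> (u, v) \<notin> (linked (A - {{u, v}}))\<^sup>*)"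

lemma linked_mono: "A \<subseteq> B \<Longrightarrow> (linked A)\<^sup>* \<subseteq> (linked B)\<^sup>*"
  by (rule rtrancl_mono) (auto simp: linked_def)

lemma linked_sym: "(u, v) \<in> (linked A)\<^sup>* \<Longrightarrow> (v, u) \<in> (linked A)\<^sup>*"
proof -
  have "sym (linked A)" by (auto simp: sym_def linked_def insert_commute)
  then show "(u, v) \<in> (linked A)\<^sup>* \<Longrightarrow> (v, u) \<in> (linked A)\<^sup>*"
    using sym_rtrancl symD by metis
qed

lemma acyclic_edges_mono: "acyclic_edges B \<Longrightarrow> A \<subseteq> B \<Longrightarrow> acyclic_edges A"
  unfolding acyclic_edges_def using linked_mono by (meson Diff_mono order_refl subset_iff)

text \<open>
  A walk that uses the new edge several times can be shortened to one that crosses it at most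
  once.
\<close>
lemma linked_insert:
  assumes "(a, b) \<in> (linked (insert {u, v} A))\<^sup>*"
  shows "(a, b) \<in> (linked A)\<^sup>*
    \<or> ((a, u) \<in> (linked A)\<^sup>* \<and> (v, b) \<in> (linked A)\<^sup>*)
    \<or> ((a, v) \<in> (linked A)\<^sup>* \<and> (u, b) \<in> (linked A)\<^sup>*)"
  using assms
proof (induction rule: rtrancl_induct)
  case base
  then show ?case by simp
next
  case (step y z)
  from step(2) consider "(y, z) \<in> linked A" | "y = u" "z = v" | "y = v" "z = u"
    by (auto simp: linked_def doubleton_eq_iff)
  then show ?case
  proof cases
    case 1
    then show ?thesis using step.IH by (meson rtrancl.rtrancl_into_rtrancl)
  next
    case 2
    then show ?thesis using step.IH linked_sym by (metis rtrancl.rtrancl_refl rtrancl_trans)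
  next
    case 3
    then show ?thesis using step.IH linked_sym by (metis rtrancl.rtrancl_refl rtrancl_trans)
  qed
qed

text \<open>
  A cycle created by the new edge \<open>uv\<close> passes through it, so the rest of that cycle
  connects \<open>u\<close> and \<open>v\<close> inside \<open>T\<close>.
\<close>
lemma acyclic_edges_insert:
  assumes T: "acyclic_edges T" and uv: "(u, v) \<notin> (linked T)\<^sup>*"
  shows "acyclic_edges (insert {u, v} T)"
  unfolding acyclic_edges_def
proof (intro allI impI notI)
  fix a b
  assume ab: "{a, b} \<in> insert {u, v} T"
    and path: "(a, b) \<in> (linked (insert {u, v} T - {{a, b}}))\<^sup>*"
  show False
  proof (cases "{a, b} = {u, v}")
    case True
    then have "(a, b) \<in> (linked T)\<^sup>*"
      using path linked_mono[of "insert {u, v} T - {{a, b}}" T] by blast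
    with True uv show False by (metis doubleton_eq_iff linked_sym)
  next
    case False
    define S where "S = T - {{a, b}}"
    have ST: "(linked S)\<^sup>* \<subseteq> (linked T)\<^sup>*" by (simp add: S_def linked_mono)
    have abT: "{a, b} \<in> T" using ab False by auto
    then have ab1: "(a, b) \<in> (linked T)\<^sup>*" by (auto simp: linked_def)
    have ba1: "(b, a) \<in> (linked T)\<^sup>*" using ab1 by (rule linked_sym)
    have "insert {u, v} T - {{a, b}} = insert {u, v} S" using False by (auto simp: S_def)
    with path have "(a, b) \<in> (linked (insert {u, v} S))\<^sup>*" by simp
    moreover have "(a, b) \<notin> (linked S)\<^sup>*" using T abT by (auto simp: acyclic_edges_def S_def)
    ultimately consider "(a, u) \<in> (linked S)\<^sup>*" "(v, b) \<in> (linked S)\<^sup>*"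
      | "(a, v) \<in> (linked S)\<^sup>*" "(u, b) \<in> (linked S)\<^sup>*"
      using linked_insert[of a b u v S] by blast
    then have "(u, v) \<in> (linked T)\<^sup>*"
    proof cases
      case 1
      then have "(u, a) \<in> (linked T)\<^sup>*" "(b, v) \<in> (linked T)\<^sup>*"
        using subsetD[OF ST] by (simp_all add: linked_sym)
      then show ?thesis using ab1 by (meson rtrancl_trans)
    next
      case 2
      then have "(u, b) \<in> (linked T)\<^sup>*" "(a, v) \<in> (linked T)\<^sup>*" using ST by blast+
      then show ?thesis using ba1 by (meson rtrancl_trans)
    qed
    with uv show False ..
  qed
qed

definition graph_edges :: "'a set \<Rightarrow> 'a set set \<Rightarrow> bool" where
  "graph_edges X A \<longleftrightarrow> (\<forall>e \<in> A. \<exists>u v. u \<in> X \<and> v \<in> X \<and> u \<noteq> v \<and> e = {u, v})"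

lemma graph_edgesE:
  assumes "graph_edges X A" "e \<in> A"
  obtains u v where "u \<in> X" "v \<in> X" "u \<noteq> v" "e = {u, v}"
  using assms unfolding graph_edges_def by metis

lemma graph_edges_subset:
  assumes "graph_edges X A" "B \<subseteq> A" "\<And>e. e \<in> B \<Longrightarrow> e \<subseteq> Y"
  shows "graph_edges Y B"
  unfolding graph_edges_def
proof
  fix e assume e: "e \<in> B"
  then have "e \<in> A" using assms(2) by blast
  from graph_edgesE[OF assms(1) this] obtain u v where "u \<noteq> v" "e = {u, v}" by metis
  with assms(3)[OF e] show "\<exists>u v. u \<in> Y \<and> v \<in> Y \<and> u \<noteq> v \<and> e = {u, v}" by auto
qed

lemma graph_edges_finite: "graph_edges X A \<Longrightarrow> finite X \<Longrightarrow> finite A"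
  by (rule finite_subset[of A "Pow X"]) (auto simp: graph_edges_def)

text \<open>
  Deleting an edge \<open>uv\<close> separates the vertices that can still be reached from \<open>u\<close>
  from the others, and both parts carry smaller forests.
\<close>
lemma card_forest:
  assumes "finite X" "X \<noteq> {}" "graph_edges X A" "acyclic_edges A"
  shows "card A < card X"
  using assms
proof (induction "card A" arbitrary: X A rule: less_induct)
  case less
  have finA: "finite A" using less.prems graph_edges_finite by blast
  show ?case
  proof (cases "A = {}")
    case True
    then show ?thesis using less.prems(1,2) by (simp add: card_gt_0_iff)
  next
    case False
    then obtain e where "e \<in> A" by blast
    then obtain u v where uv: "{u, v} \<in> A" "u \<in> X" "v \<in> X"
      using graph_edgesE[OF less.prems(3)] by metis
    define S where "S = A - {{u, v}}"
    define R where "R = {w \<in> X. (u, w) \<in> (linked S)\<^sup>*}"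
    have vR: "v \<notin> R" using less.prems(4) uv by (auto simp: acyclic_edges_def R_def S_def)
    have uR: "u \<in> R" using uv by (simp add: R_def)
    define A1 where "A1 = {f \<in> S. f \<subseteq> R}"
    define A2 where "A2 = {f \<in> S. f \<inter> R = {}}"
    have ends: "\<exists>a b. a \<in> X \<and> b \<in> X \<and> f = {a, b}" if "f \<in> S" for f
    proof -
      from that have "f \<in> A" by (simp add: S_def)
      from graph_edgesE[OF less.prems(3) this] show ?thesis by metis
    qed
    have split: "f \<subseteq> R \<or> f \<inter> R = {}" if "f \<in> S" for f
    proof -
      obtain a b where ab: "f = {a, b}" "a \<in> X" "b \<in> X"
        using ends[OF \<open>f \<in> S\<close>] by blast
      then have "(a, b) \<in> linked S" "(b, a) \<in> linked S"
        using \<open>f \<in> S\<close> by (auto simp: linked_def insert_commute)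
      then show ?thesis unfolding ab R_def using ab
        by (auto intro: rtrancl.rtrancl_into_rtrancl)
    qed
    have S1: "S = A1 \<union> A2" using split by (auto simp: A1_def A2_def)
    have "f \<noteq> {}" if "f \<in> S" for f using ends[OF that] by blast
    then have S2: "A1 \<inter> A2 = {}" by (auto simp: A1_def A2_def)
    have finS: "finite S" using finA by (simp add: S_def)
    have cS: "card S < card A" using finA uv unfolding S_def by (intro card_Diff1_less)
    have fin12: "finite A1" "finite A2" using finS by (auto simp: S1)
    have c12: "card S = card A1 + card A2" using S2 fin12 unfolding S1 by (simp add: card_Un_disjoint)
    have "card A1 < card R"
    proof (rule less.hyps)
      show "card A1 < card A" using c12 cS by simp
      show "finite R" using less.prems by (simp add: R_def)
      show "R \<noteq> {}" using uR by auto
      show "graph_edges R A1" using less.prems(3)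
        by (rule graph_edges_subset) (auto simp: A1_def S_def)
      show "acyclic_edges A1" using less.prems(4) by (rule acyclic_edges_mono) (auto simp: A1_def S_def)
    qed
    moreover have "card A2 < card (X - R)"
    proof (rule less.hyps)
      show "card A2 < card A" using c12 cS by simp
      show "finite (X - R)" using less.prems by simp
      show "X - R \<noteq> {}" using vR uv by auto
      show "graph_edges (X - R) A2" using less.prems(3)
      proof (rule graph_edges_subset)
        fix f assume f: "f \<in> A2"
        then have "f \<in> S" by (simp add: A2_def)
        from ends[OF this] obtain a b where "a \<in> X" "b \<in> X" "f = {a, b}" by blast
        with f show "f \<subseteq> X - R" by (auto simp: A2_def)
      qed (auto simp: A2_def S_def)
      show "acyclic_edges A2" using less.prems(4) by (rule acyclic_edges_mono) (auto simp: A2_def S_def)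
    qed
    moreover have "card X = card R + card (X - R)"
      using less.prems(1) card_Diff_subset[of R X] card_mono[of X R]
      by (simp add: R_def finite_subset)
    moreover have "card A = Suc (card S)" using finA uv unfolding S_def
      by (metis card_Suc_Diff1)
    ultimately show ?thesis using c12 by linarith
  qed
qed

text \<open>
  When the walk returns to an earlier vertex, the loop is cut out.
\<close>
lemma linked_simple_path:
  assumes "(u, v) \<in> (linked A)\<^sup>*"
  obtains ws where "ws \<noteq> []" "hd ws = u" "last ws = v" "distinct ws"
    "successively (\<lambda>x y. {x, y} \<in> A) ws"
proof -
  from assms have "\<exists>ws. ws \<noteq> [] \<and> hd ws = u \<and> last ws = v \<and> distinct ws
    \<and> successively (\<lambda>x y. {x, y} \<in> A) ws"
  proof (induction rule: rtrancl_induct)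
    case base
    show ?case by (rule exI[of _ "[u]"]) simp
  next
    case (step y z)
    then obtain ws where ws: "ws \<noteq> []" "hd ws = u" "last ws = y" "distinct ws"
      "successively (\<lambda>x y. {x, y} \<in> A) ws" by blast
    show ?case
    proof (cases "z \<in> set ws")
      case True
      then obtain xs ys where "ws = xs @ z # ys" by (meson split_list)
      then show ?thesis using ws
        by (intro exI[of _ "xs @ [z]"])
           (auto simp: successively_append_iff successively_Cons hd_append)
    next
      case False
      then show ?thesis using ws step(2)
        by (intro exI[of _ "ws @ [z]"])
           (auto simp: successively_append_iff linked_def)
    qed
  qed
  then show ?thesis using that by blast
qed

text \<open>
  Counting all edges spanned by the vertices of the path, instead of its own edges, lets the
  induction drop the first vertex.
\<close>
lemma path_edges_card:
  assumes "finite A" "distinct ws" "successively (\<lambda>x y. {x, y} \<in> A) ws"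
  shows "length ws \<le> Suc (card {f \<in> A. f \<subseteq> set ws})"
  using assms(2,3)
proof (induction ws rule: induct_list012)
  case (3 a b ws)
  let ?F = "\<lambda>ws. {f \<in> A. f \<subseteq> set ws}"
  have sub: "insert {a, b} (?F (b # ws)) \<subseteq> ?F (a # b # ws)" using 3 by auto
  have "{a, b} \<notin> ?F (b # ws)" using 3 by auto
  moreover have fin: "finite (?F xs)" for xs using assms(1) by simp
  ultimately have "card (insert {a, b} (?F (b # ws))) = Suc (card (?F (b # ws)))"
    by (intro card_insert_disjoint)
  moreover have "card (insert {a, b} (?F (b # ws))) \<le> card (?F (a # b # ws))"
    using sub by (rule card_mono[OF fin])
  ultimately have "Suc (card (?F (b # ws))) \<le> card (?F (a # b # ws))" by simp
  moreover have "length (b # ws) \<le> Suc (card (?F (b # ws)))" using 3 by simp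
  ultimately show ?case by simp
qed auto

definition cycle_verts :: "'a set set \<Rightarrow> 'a list \<Rightarrow> bool" where
  "cycle_verts A ws \<longleftrightarrow> 3 \<le> length ws \<and> distinct ws
     \<and> successively (\<lambda>x y. {x, y} \<in> A) ws \<and> {last ws, hd ws} \<in> A"

lemma cyclic_edges_card:
  assumes X: "graph_edges X A" "finite X" and cyc: "\<not> acyclic_edges A"
  obtains ws where "cycle_verts A ws" "length ws \<le> card A"
proof -
  have finA: "finite A" using X graph_edges_finite by blast
  obtain u v where uv: "{u, v} \<in> A" "(u, v) \<in> (linked (A - {{u, v}}))\<^sup>*"
    using cyc by (auto simp: acyclic_edges_def)
  then obtain ws where ws: "ws \<noteq> []" "hd ws = u" "last ws = v" "distinct ws"
    "successively (\<lambda>x y. {x, y} \<in> A - {{u, v}}) ws"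
    by (metis linked_simple_path)
  have uvn: "u \<noteq> v" using graph_edgesE[OF X(1) uv(1)] by (metis doubleton_eq_iff)
  have "3 \<le> length ws"
  proof (rule ccontr)
    assume "\<not> 3 \<le> length ws"
    then consider "length ws = 1" | "length ws = 2"
      using ws(1) length_greater_0_conv[of ws] by linarith
    then show False
    proof cases
      case 1
      then show ?thesis using ws uvn by (cases ws) auto
    next
      case 2
      then have "ws = [u, v]" using ws by (cases ws; cases "tl ws") auto
      then show ?thesis using ws(5) by simp
    qed
  qed
  moreover have "successively (\<lambda>x y. {x, y} \<in> A) ws"
    by (rule successively_mono[OF ws(5)]) auto
  moreover have "length ws \<le> card A"
  proof -
    have "length ws \<le> Suc (card {f \<in> A - {{u, v}}. f \<subseteq> set ws})"
      using path_edges_card[OF _ ws(4,5)] finA by simp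
    also have "card {f \<in> A - {{u, v}}. f \<subseteq> set ws} \<le> card (A - {{u, v}})"
      using finA by (intro card_mono) auto
    also have "Suc (card (A - {{u, v}})) = card A" using finA uv by (metis card_Suc_Diff1)
    finally show ?thesis by simp
  qed
  moreover have "{last ws, hd ws} \<in> A" using uv ws(2,3) by (simp add: insert_commute)
  ultimately have "cycle_verts A ws \<and> length ws \<le> card A"
    using ws(4) unfolding cycle_verts_def by blast
  then show ?thesis using that by blast
qed

section \<open>Plane drawings\<close>

lemma inside_or_outside:
  fixes c :: "real \<Rightarrow> complex"
  assumes "simple_path c" "pathfinish c = pathstart c" "connected f" "f \<noteq> {}"
    "f \<inter> path_image c = {}"
  shows "f \<subseteq> inside (path_image c) \<longleftrightarrow> \<not> f \<subseteq> outside (path_image c)"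
proof -
  note J = Jordan_inside_outside[OF assms(1,2)]
  have "f \<subseteq> inside (path_image c) \<union> outside (path_image c)" using J assms(5) by blast
  moreover have "f \<inter> inside (path_image c) = {} \<or> f \<inter> outside (path_image c) = {}"
    using connectedD[OF assms(3), of "inside (path_image c)" "outside (path_image c)"] J calculation
    by blast
  moreover have "inside (path_image c) \<inter> outside (path_image c) = {}" using J by blast
  ultimately show ?thesis using assms(4) by blast
qed

text \<open>
  This lemma and the previous one turn the Jordan curve theorem into a two-valued label: a connected
  set that misses the curve is on one side of it, and points with equal labels are not separated.
\<close>
lemma same_side:
  fixes c :: "real \<Rightarrow> complex"
  assumes "simple_path c" "pathfinish c = pathstart c"
    and "x \<in> inside (path_image c) \<and> y \<in> inside (path_image c)
      \<or> x \<in> outside (path_image c) \<and> y \<in> outside (path_image c)"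
  shows "connected_component (- path_image c) x y"
proof -
  note J = Jordan_inside_outside[OF assms(1,2)]
  have "inside (path_image c) \<subseteq> - path_image c" "outside (path_image c) \<subseteq> - path_image c"
    using J by blast+
  moreover have "connected (inside (path_image c))" "connected (outside (path_image c))" using J by blast+
  ultimately show ?thesis using assms(3) unfolding connected_component_def by blast
qed

text \<open>
  The drawing is kept apart from digraphs, because the induction over edges treats arbitrary
  subsets of the edge set, all with the same arcs.
\<close>
locale plane_graph =
  fixes V :: "'a set" and E :: "'a set set"
    and pos :: "'a \<Rightarrow> complex" and crv :: "'a set \<Rightarrow> real \<Rightarrow> complex"
  assumes finV: "finite V" and edges: "graph_edges V E"
    and inj: "inj_on pos V"
    and arc: "e \<in> E \<Longrightarrow> arc (crv e)"
    and ends: "e \<in> E \<Longrightarrow> {pathstart (crv e), pathfinish (crv e)} = pos ` e"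
    and meets_verts: "e \<in> E \<Longrightarrow> path_image (crv e) \<inter> pos ` V = pos ` e"
    and meets_edges: "e \<in> E \<Longrightarrow> f \<in> E \<Longrightarrow> e \<noteq> f \<Longrightarrow>
      path_image (crv e) \<inter> path_image (crv f) = pos ` (e \<inter> f)"
begin

definition drawing :: "'a set \<Rightarrow> 'a set set \<Rightarrow> complex set" where
  "drawing X A = pos ` X \<union> (\<Union>e\<in>A. path_image (crv e))"

definition interior_arc :: "'a set \<Rightarrow> complex set" where
  "interior_arc e = path_image (crv e) - pos ` e"

abbreviation faces :: "'a set set \<Rightarrow> complex set set" where
  "faces A \<equiv> components (- drawing V A)"

lemma finE: "finite E"
  using edges finV by (rule graph_edges_finite)

lemma edge_subset: "e \<in> E \<Longrightarrow> e \<subseteq> V"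
  using graph_edgesE[OF edges] by (metis insert_subset empty_subsetI)

lemma compact_drawing: "A \<subseteq> E \<Longrightarrow> finite X \<Longrightarrow> compact (drawing X A)"
  unfolding drawing_def using finE arc
  by (intro compact_Un compact_UN finite_imp_compact finite_imageI compact_arc_image)
     (auto intro: finite_subset)

lemma closed_drawing: "A \<subseteq> E \<Longrightarrow> closed (drawing V A)"
  using compact_drawing finV compact_imp_closed by blast

lemma drawing_insert: "drawing V (insert e A) = drawing V A \<union> path_image (crv e)"
  by (auto simp: drawing_def)

lemma drawing_edge: "e \<in> E \<Longrightarrow> drawing e {e} = path_image (crv e)"
  using meets_verts[of e] by (auto simp: drawing_def)

text \<open>
  Two parts of the drawing without common edges meet exactly in their common vertices. Janiszewski's
  theorem requires a connected intersection, so it applies as soon as the common part is a single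
  vertex or a path.
\<close>
lemma drawing_Int:
  assumes "A \<subseteq> E" "B \<subseteq> E" "A \<inter> B = {}" "X \<subseteq> V" "Y \<subseteq> V"
    and "\<And>e. e \<in> A \<Longrightarrow> e \<subseteq> X" "\<And>e. e \<in> B \<Longrightarrow> e \<subseteq> Y"
  shows "drawing X A \<inter> drawing Y B = pos ` (X \<inter> Y)"
proof
  show "pos ` (X \<inter> Y) \<subseteq> drawing X A \<inter> drawing Y B" by (auto simp: drawing_def)
  show "drawing X A \<inter> drawing Y B \<subseteq> pos ` (X \<inter> Y)"
  proof
    fix z assume z: "z \<in> drawing X A \<inter> drawing Y B"
    have img: "pos ` C \<inter> pos ` D = pos ` (C \<inter> D)" if "C \<subseteq> V" "D \<subseteq> V" for C D
      using inj_on_image_Int[OF inj that] by simp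
    from z consider "z \<in> pos ` X" "z \<in> pos ` Y"
      | e where "e \<in> B" "z \<in> pos ` X" "z \<in> path_image (crv e)"
      | e where "e \<in> A" "z \<in> pos ` Y" "z \<in> path_image (crv e)"
      | e f where "e \<in> A" "f \<in> B" "z \<in> path_image (crv e)" "z \<in> path_image (crv f)"
      unfolding drawing_def by blast
    then show "z \<in> pos ` (X \<inter> Y)"
    proof cases
      case 1
      then show ?thesis using img assms by blast
    next
      case 2
      then have "z \<in> pos ` e" using meets_verts[of e] assms by blast
      then have "z \<in> pos ` Y" using assms(7)[OF 2(1)] by blast
      then show ?thesis using img[OF assms(4,5)] 2 by blast
    next
      case 3
      then have "z \<in> pos ` e" using meets_verts[of e] assms by blast
      then have "z \<in> pos ` X" using assms(6)[OF 3(1)] by blast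
      then show ?thesis using img[OF assms(4,5)] 3 by blast
    next
      case 4
      then have "z \<in> pos ` (e \<inter> f)" using meets_edges[of e f] assms by blast
      then show ?thesis using assms(6)[OF 4(1)] assms(7)[OF 4(2)] by blast
    qed
  qed
qed

lemma drawing_Int_edge:
  assumes "A \<subseteq> E" "e \<in> E" "e \<notin> A"
  shows "drawing V A \<inter> path_image (crv e) = pos ` e"
proof -
  have "drawing V A \<inter> drawing e {e} = pos ` (V \<inter> e)"
    using assms edge_subset by (intro drawing_Int) auto
  then show ?thesis using assms edge_subset[of e] by (simp add: drawing_edge Int_absorb1)
qed

lemma edge_arc:
  assumes "{u, v} \<in> E"
  obtains h where "arc h" "path_image h = path_image (crv {u, v})"
    "pathstart h = pos u" "pathfinish h = pos v"
proof -
  have "{pathstart (crv {u, v}), pathfinish (crv {u, v})} = {pos u, pos v}"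
    using ends[OF assms] by simp
  then consider "pathstart (crv {u, v}) = pos u" "pathfinish (crv {u, v}) = pos v"
    | "pathstart (crv {u, v}) = pos v" "pathfinish (crv {u, v}) = pos u"
    by (metis doubleton_eq_iff)
  then show ?thesis
  proof cases
    case 1
    then show ?thesis using that[of "crv {u, v}"] arc[OF assms] by simp
  next
    case 2
    then show ?thesis using that[of "reversepath (crv {u, v})"] arc[OF assms]
      by (simp add: arc_reversepath)
  qed
qed

lemma linked_path_component:
  assumes "A \<subseteq> E" "u \<in> V" "(u, v) \<in> (linked A)\<^sup>*"
  shows "path_component (drawing V A) (pos u) (pos v)"
  using assms(3)
proof (induction rule: rtrancl_induct)
  case base
  then show ?case using assms(2) by (simp add: drawing_def path_component_refl)
next
  case (step y z)
  then have yz: "{y, z} \<in> A" by (simp add: linked_def)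
  then obtain h where "arc h" "path_image h = path_image (crv {y, z})"
    "pathstart h = pos y" "pathfinish h = pos z" using edge_arc assms(1) by blast
  moreover have "path_image (crv {y, z}) \<subseteq> drawing V A" using yz by (auto simp: drawing_def)
  ultimately have "path_component (drawing V A) (pos y) (pos z)"
    unfolding path_component_def using arc_imp_path by metis
  with step.IH show ?case by (rule path_component_trans)
qed

lemma interior_arc_props:
  assumes "e \<in> E"
  shows "connected (interior_arc e)" "interior_arc e \<noteq> {}"
    "path_image (crv e) = interior_arc e \<union> pos ` e"
proof -
  have s: "simple_path (crv e)" using arc[OF assms] by (rule arc_imp_simple_path)
  have eq: "interior_arc e = path_image (crv e) - {pathstart (crv e), pathfinish (crv e)}"
    by (simp add: interior_arc_def ends[OF assms])
  show "connected (interior_arc e)" unfolding eq using connected_simple_path_endless[OF s] .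
  show "interior_arc e \<noteq> {}" unfolding eq using nonempty_simple_path_endless[OF s] .
  show "path_image (crv e) = interior_arc e \<union> pos ` e"
    using meets_verts[OF assms] by (auto simp: interior_arc_def)
qed

lemma interior_arc_disjoint:
  assumes "A \<subseteq> E" "e \<in> E" "e \<notin> A"
  shows "interior_arc e \<subseteq> - drawing V A"
  using drawing_Int_edge[OF assms] by (auto simp: interior_arc_def)

text \<open>
  The edge \<open>uv\<close> together with a path from \<open>u\<close> to \<open>v\<close> in \<open>A\<close> forms a
  Jordan curve, which meets the drawing of \<open>A\<close> in an arc. By Janiszewski's theorem, two
  points that are separated neither by the drawing nor by the curve are not separated by the union
  of both.
\<close>
lemma closing_curve:
  assumes "A \<subseteq> E" "{u, v} \<in> E" "{u, v} \<notin> A" "(u, v) \<in> (linked A)\<^sup>*"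
  obtains c where "simple_path c" "pathfinish c = pathstart c"
    "path_image (crv {u, v}) \<subseteq> path_image c"
    "path_image c \<subseteq> drawing V (insert {u, v} A)"
    "\<And>x y. connected_component (- drawing V A) x y \<Longrightarrow>
       connected_component (- path_image c) x y \<Longrightarrow>
       connected_component (- drawing V (insert {u, v} A)) x y"
proof -
  let ?e = "{u, v}"
  have uv: "u \<in> V" "v \<in> V" "u \<noteq> v"
    using graph_edgesE[OF edges assms(2)] by (metis doubleton_eq_iff)+
  then have puv: "pos u \<noteq> pos v" using inj by (auto dest: inj_onD)
  obtain p where p: "path p" "path_image p \<subseteq> drawing V A" "pathstart p = pos u" "pathfinish p = pos v"
    using linked_path_component[OF assms(1) uv(1) assms(4)] unfolding path_component_def by blast
  obtain q where q: "arc q" "path_image q \<subseteq> path_image p" "pathstart q = pos u" "pathfinish q = pos v"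
    using path_contains_arc[OF p(1,3,4) puv] by blast
  have "{v, u} \<in> E" using assms(2) by (simp add: insert_commute)
  then obtain h where h: "arc h" "path_image h = path_image (crv ?e)"
    "pathstart h = pos v" "pathfinish h = pos u"
    using edge_arc[of v u] by (metis insert_commute)
  have meet: "drawing V A \<inter> path_image h = {pos u, pos v}"
    using drawing_Int_edge[OF assms(1-3)] h(2) by simp
  have qA: "path_image q \<subseteq> drawing V A" using p q by blast
  have qends: "{pos u, pos v} \<subseteq> path_image q"
    using pathstart_in_path_image[of q] pathfinish_in_path_image[of q] q by simp
  let ?c = "q +++ h"
  have img: "path_image ?c = path_image q \<union> path_image h"
    using q h by (simp add: path_image_join)
  show ?thesis
  proof (rule that[of ?c])
    show "simple_path ?c"
      using q h meet qA by (intro simple_path_join_loop) auto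
    show "pathfinish ?c = pathstart ?c" using q h by simp
    show "path_image (crv ?e) \<subseteq> path_image ?c" using img h by auto
    show "path_image ?c \<subseteq> drawing V (insert ?e A)"
      using img h(2) qA by (auto simp: drawing_insert)
    fix x y
    assume xy: "connected_component (- drawing V A) x y" "connected_component (- path_image ?c) x y"
    \<comment> \<open>The edge meets the drawing only in its ends, and these lie on \<open>q\<close>.\<close>
    have "drawing V A \<inter> path_image ?c = path_image q" using meet qA qends img by blast
    moreover have "closed (path_image ?c)"
      unfolding img using q(1) h(1) by (intro closed_Un closed_arc_image)
    ultimately have "connected_component (- (drawing V A \<union> path_image ?c)) x y"
      using xy compact_drawing[OF assms(1) finV] q(1)
      by (intro Janiszewski) (simp_all add: connected_arc_image)
    moreover have "drawing V A \<union> path_image ?c = drawing V (insert ?e A)"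
      using img h(2) qA by (auto simp: drawing_insert)
    ultimately show "connected_component (- drawing V (insert ?e A)) x y" by simp
  qed
qed

text \<open>
  Cut \<open>A\<close> into the part that is reachable from \<open>u\<close> and the rest. The new arc meets
  the first part only in \<open>u\<close>, and the second part meets both of them together only in
  \<open>v\<close>, so two applications of Janiszewski's theorem put the pieces back together.
\<close>
lemma bridge_no_separation:
  assumes "A \<subseteq> E" "{u, v} \<in> E" "{u, v} \<notin> A" "(u, v) \<notin> (linked A)\<^sup>*"
    and xy: "connected_component (- drawing V A) x y"
    and x: "x \<notin> path_image (crv {u, v})" and y: "y \<notin> path_image (crv {u, v})"
  shows "connected_component (- drawing V (insert {u, v} A)) x y"
proof -
  let ?e = "{u, v}"
  have uv: "u \<in> V" "v \<in> V" "u \<noteq> v"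
    using graph_edgesE[OF edges assms(2)] by (metis doubleton_eq_iff)+
  define R where "R = {w \<in> V. (u, w) \<in> (linked A)\<^sup>*}"
  have uR: "u \<in> R" and vR: "v \<notin> R" using uv assms(4) by (auto simp: R_def)
  have RV: "R \<subseteq> V" by (auto simp: R_def)
  define A1 where "A1 = {f \<in> A. f \<subseteq> R}"
  define A2 where "A2 = A - A1"
  have A2sub: "f \<subseteq> V - R" if "f \<in> A2" for f
  proof -
    have fA: "f \<in> A" and nR: "\<not> f \<subseteq> R" using that by (auto simp: A2_def A1_def)
    then have "f \<in> E" using assms(1) by blast
    from graph_edgesE[OF edges this] obtain a b where ab: "a \<in> V" "b \<in> V" "f = {a, b}" by metis
    then have "(a, b) \<in> linked A" "(b, a) \<in> linked A"
      using fA by (auto simp: linked_def insert_commute)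
    then have "a \<in> R \<longleftrightarrow> b \<in> R" using ab unfolding R_def
      by (auto intro: rtrancl.rtrancl_into_rtrancl)
    then show ?thesis using nR ab by auto
  qed
  have A1: "A1 \<subseteq> E" and A2: "A2 \<subseteq> E" using assms(1) by (auto simp: A1_def A2_def)
  have d: "drawing V A = drawing R A1 \<union> drawing (V - R) A2"
    using RV by (auto simp: drawing_def A1_def A2_def)
  have cl: "compact (drawing R A1)" "compact (drawing (V - R) A2)"
    using compact_drawing A1 A2 finV RV by (meson finite_subset finite_Diff)+
  have arcE: "path_image (crv ?e) = drawing ?e {?e}" using drawing_edge[OF assms(2)] by simp
  have 1: "connected_component (- (drawing R A1 \<union> path_image (crv ?e))) x y"
  proof (rule Janiszewski)
    have "drawing R A1 \<inter> drawing ?e {?e} = pos ` (R \<inter> ?e)"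
      using A1 assms(2,3) RV uv by (intro drawing_Int) (auto simp: A1_def)
    also have "R \<inter> ?e = {u}" using uR vR by auto
    finally show "connected (drawing R A1 \<inter> path_image (crv ?e))" by (simp add: arcE)
    show "connected_component (- drawing R A1) x y"
      by (rule connected_component_of_subset[OF xy]) (auto simp: d)
    have "connected (- path_image (crv ?e))"
      using connected_arc_complement[OF arc[OF assms(2)]] by simp
    then show "connected_component (- path_image (crv ?e)) x y"
      using x y by (simp add: connected_iff_connected_component)
  qed (use cl arc[OF assms(2)] in \<open>auto simp: closed_arc_image\<close>)
  have "connected_component (- (drawing (V - R) A2 \<union> (drawing R A1 \<union> path_image (crv ?e)))) x y"
  proof (rule Janiszewski)
    have "drawing (V - R) A2 \<inter> drawing (insert v R) (insert ?e A1) = pos ` ((V - R) \<inter> insert v R)"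
      using A1 A2 assms(2,3) RV uv uR A2sub by (intro drawing_Int) (auto simp: A1_def A2_def)
    also have "(V - R) \<inter> insert v R = {v}" using vR uv by auto
    also have "drawing (insert v R) (insert ?e A1) = drawing R A1 \<union> path_image (crv ?e)"
      using meets_verts[OF assms(2)] by (auto simp: drawing_def)
    finally show "connected (drawing (V - R) A2 \<inter> (drawing R A1 \<union> path_image (crv ?e)))" by simp
    show "connected_component (- drawing (V - R) A2) x y"
      by (rule connected_component_of_subset[OF xy]) (auto simp: d)
    show "connected_component (- (drawing R A1 \<union> path_image (crv ?e))) x y" by (rule 1)
    show "closed (drawing R A1 \<union> path_image (crv ?e))"
      using cl arc[OF assms(2)] by (auto simp: closed_arc_image compact_imp_closed intro: closed_Un)
  qed (use cl in auto)
  moreover have "drawing (V - R) A2 \<union> (drawing R A1 \<union> path_image (crv ?e)) = drawing V (insert ?e A)"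
    by (auto simp: d drawing_insert)
  ultimately show ?thesis by simp
qed

subsection \<open>Faces\<close>

text \<open>
  An edge that meets the closure of a face only in its ends does not touch it.
\<close>
definition touching :: "'a set set \<Rightarrow> complex set \<Rightarrow> 'a set set" where
  "touching A f = {e \<in> A. closure f \<inter> interior_arc e \<noteq> {}}"

lemma open_face: "A \<subseteq> E \<Longrightarrow> f \<in> faces A \<Longrightarrow> open f"
  using closed_drawing open_components open_Compl by blast

lemma face_props: "f \<in> faces A \<Longrightarrow> f \<noteq> {} \<and> connected f \<and> f \<subseteq> - drawing V A"
  using in_components_nonempty in_components_connected in_components_subset by metis

lemma faces_same:
  assumes "f \<in> faces A" "g \<in> faces A" "x \<in> f" "y \<in> g"
    and "connected_component (- drawing V A) x y"
  shows "f = g"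
proof -
  obtain T where T: "connected T" "T \<subseteq> - drawing V A" "x \<in> T" "y \<in> T"
    using assms(5) by (auto simp: connected_component_def)
  show ?thesis
    using joinable_components_eq[of T "- drawing V A" f g] T assms(1-4) by blast
qed

lemma face_connected_component:
  "f \<in> faces A \<Longrightarrow> x \<in> f \<Longrightarrow> y \<in> f \<Longrightarrow> connected_component (- drawing V A) x y"
  using face_props by (metis connected_component_def)

lemma face_around_edge:
  assumes "A \<subseteq> E" "e \<in> E" "e \<notin> A"
  obtains U where "U \<in> faces A" "interior_arc e \<subseteq> U"
  using exists_component_superset[OF interior_arc_disjoint[OF assms]]
    interior_arc_props[OF assms(2)] interior_arc_disjoint[OF assms] by (metis subset_empty)

text \<open>
  Before \<open>e\<close> was drawn, its interior lay in an open face \<open>U\<close>, so a face of the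
  new drawing that comes close to the interior of \<open>e\<close> meets \<open>U\<close> and hence is a part
  of it.
\<close>
lemma touching_face_subset:
  assumes "A \<subseteq> E" "e \<in> E" "e \<notin> A" "U \<in> faces A" "interior_arc e \<subseteq> U"
    and f: "f \<in> faces (insert e A)" "e \<in> touching (insert e A) f"
  shows "f \<subseteq> U"
proof -
  have "U \<inter> closure f \<noteq> {}" using f(2) assms(5) by (auto simp: touching_def)
  then have "U \<inter> f \<noteq> {}"
    using open_Int_closure_eq_empty[OF open_face[OF assms(1,4)]] by blast
  moreover have "f \<subseteq> - drawing V A" using face_props[OF f(1)] by (auto simp: drawing_insert)
  ultimately show ?thesis
    using components_maximal[OF assms(4)] face_props[OF f(1)] by blast
qed

text \<open>
  The parts of \<open>U\<close> are distinguished by the side of the closing curve on which they lie; if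
  the edge closes no curve, there is only one part.
\<close>
lemma faces_in_face:
  assumes "A \<subseteq> E" "e \<in> E" "e \<notin> A" "U \<in> faces A"
  shows "finite {f \<in> faces (insert e A). f \<subseteq> U} \<and> card {f \<in> faces (insert e A). f \<subseteq> U} \<le> 2"
proof -
  let ?N = "{f \<in> faces (insert e A). f \<subseteq> U}"
  obtain u v where uv: "e = {u, v}" using graph_edgesE[OF edges assms(2)] by metis
  note a = assms(1) assms(2,3)[unfolded uv]
  have "\<exists>side :: complex set \<Rightarrow> bool. inj_on side ?N"
  proof (cases "(u, v) \<in> (linked A)\<^sup>*")
    case True
    obtain c where c: "simple_path c" "pathfinish c = pathstart c"
      "path_image c \<subseteq> drawing V (insert {u, v} A)"
      and join: "\<And>x y. connected_component (- drawing V A) x y \<Longrightarrow>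
       connected_component (- path_image c) x y \<Longrightarrow>
       connected_component (- drawing V (insert {u, v} A)) x y"
      using closing_curve[OF a True] by metis
    have "inj_on (\<lambda>f. f \<subseteq> inside (path_image c)) ?N"
    proof (rule inj_onI)
      fix f g assume f: "f \<in> ?N" and g: "g \<in> ?N"
        and side: "(f \<subseteq> inside (path_image c)) = (g \<subseteq> inside (path_image c))"
      have fp: "f \<noteq> {}" "connected f" "f \<inter> path_image c = {}"
        and gp: "g \<noteq> {}" "connected g" "g \<inter> path_image c = {}"
        using face_props[of f] face_props[of g] f g c(3) uv by blast+
      obtain x y where xy: "x \<in> f" "y \<in> g" using fp gp by blast
      have "connected_component (- path_image c) x y"
        using inside_or_outside[OF c(1,2) fp(2,1,3)] inside_or_outside[OF c(1,2) gp(2,1,3)] side xy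
        by (intro same_side[OF c(1,2)]) blast
      moreover have "connected_component (- drawing V A) x y"
        using f g xy by (intro face_connected_component[OF assms(4)]) auto
      ultimately have "connected_component (- drawing V (insert e A)) x y"
        using join uv by simp
      then show "f = g" using faces_same f g xy by blast
    qed
    then show ?thesis by blast
  next
    case False
    have "inj_on (\<lambda>f. True) ?N"
    proof (rule inj_onI)
      fix f g assume f: "f \<in> ?N" and g: "g \<in> ?N"
      obtain x y where xy: "x \<in> f" "y \<in> g" using f g face_props by blast
      have "f \<subseteq> - drawing V (insert e A)" "g \<subseteq> - drawing V (insert e A)"
        using f g face_props by blast+
      then have "x \<notin> path_image (crv e)" "y \<notin> path_image (crv e)"
        using xy by (auto simp: drawing_insert)
      moreover have "connected_component (- drawing V A) x y"
        using f g xy by (intro face_connected_component[OF assms(4)]) auto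
      ultimately have "connected_component (- drawing V (insert e A)) x y"
        using bridge_no_separation[OF a False] uv by simp
      then show "f = g" using faces_same f g xy by blast
    qed
    then show ?thesis by blast
  qed
  then obtain side :: "complex set \<Rightarrow> bool" where inj: "inj_on side ?N" by blast
  have "finite ?N" using finite_imageD[OF _ inj] finite_subset[of "side ` ?N" UNIV] by simp
  moreover have "card ?N \<le> card (UNIV :: bool set)" using inj by (intro card_inj_on_le) auto
  ultimately show ?thesis by simp
qed

lemma edge_touches_two_faces:
  assumes "A \<subseteq> E" "e \<in> A"
  shows "finite {f \<in> faces A. e \<in> touching A f} \<and> card {f \<in> faces A. e \<in> touching A f} \<le> 2"
proof -
  let ?B = "A - {e}"
  have B: "?B \<subseteq> E" "e \<in> E" "e \<notin> ?B" "insert e ?B = A" using assms by auto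
  obtain U where U: "U \<in> faces ?B" "interior_arc e \<subseteq> U" using face_around_edge[OF B(1-3)] by blast
  have "{f \<in> faces A. e \<in> touching A f} \<subseteq> {f \<in> faces A. f \<subseteq> U}"
    using touching_face_subset[OF B(1-3) U] B(4) by auto
  moreover have "finite {f \<in> faces A. f \<subseteq> U} \<and> card {f \<in> faces A. f \<subseteq> U} \<le> 2"
    using faces_in_face[OF B(1-3) U(1)] B(4) by simp
  ultimately show ?thesis by (meson card_mono finite_subset le_trans)
qed

text \<open>
  Every point of a Jordan curve is a limit both of its inside and of its outside. Near an inner
  point of the new edge these two sides lie in \<open>U\<close>.
\<close>
lemma closing_edge_splits_face:
  assumes "A \<subseteq> E" "{u, v} \<in> E" "{u, v} \<notin> A" "(u, v) \<in> (linked A)\<^sup>*"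
    and "U \<in> faces A" "interior_arc {u, v} \<subseteq> U"
  obtains f g where "f \<in> faces (insert {u, v} A)" "g \<in> faces (insert {u, v} A)"
    "f \<subseteq> U" "g \<subseteq> U" "f \<noteq> g"
proof -
  let ?e = "{u, v}" and ?D = "- drawing V (insert {u, v} A)"
  obtain c where c: "simple_path c" "pathfinish c = pathstart c"
    "path_image (crv ?e) \<subseteq> path_image c" "path_image c \<subseteq> drawing V (insert ?e A)"
    using closing_curve[OF assms(1-4)] by metis
  note J = Jordan_inside_outside[OF c(1,2)]
  obtain p where p: "p \<in> interior_arc ?e" using interior_arc_props[OF assms(2)] by blast
  then have pU: "p \<in> U" and pc: "p \<in> path_image c"
    using assms(6) c(3) by (auto simp: interior_arc_def)
  have pcl: "p \<in> closure (inside (path_image c))" "p \<in> closure (outside (path_image c))"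
    using J pc by (auto simp: frontier_def)
  have oU: "open U" using open_face[OF assms(1,5)] .
  obtain x y where x: "x \<in> U" "x \<in> inside (path_image c)" and y: "y \<in> U" "y \<in> outside (path_image c)"
    using open_Int_closure_eq_empty[OF oU] pcl pU by blast
  have nc: "inside (path_image c) \<inter> path_image c = {}" "outside (path_image c) \<inter> path_image c = {}"
    using J by blast+
  have UA: "U \<subseteq> - drawing V A" using face_props[OF assms(5)] by blast
  have xD: "x \<in> ?D" and yD: "y \<in> ?D"
    using x y nc UA c(3) unfolding drawing_insert by blast+
  let ?f = "connected_component_set ?D x" and ?g = "connected_component_set ?D y"
  have fg: "?f \<in> faces (insert ?e A)" "?g \<in> faces (insert ?e A)"
    using xD yD by (auto intro: componentsI)
  have DA: "?D \<subseteq> - drawing V A" by (auto simp: drawing_insert)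
  have sub: "connected_component_set ?D z \<subseteq> U" if "z \<in> U" "z \<in> ?D" for z
  proof (rule components_maximal[OF assms(5)])
    show "connected (connected_component_set ?D z)" by simp
    show "connected_component_set ?D z \<subseteq> - drawing V A"
      using connected_component_subset DA by blast
    show "U \<inter> connected_component_set ?D z \<noteq> {}"
      using that by (auto simp: connected_component_refl_eq)
  qed
  have "?f \<noteq> ?g"
  proof
    assume eq: "?f = ?g"
    have xf: "x \<in> ?f" and yf: "y \<in> ?f" using xD yD eq by (auto simp: connected_component_refl_eq)
    have "?f \<inter> path_image c = {}" using connected_component_subset[of ?D x] c(4) by blast
    moreover have "?f \<noteq> {}" using xf by blast
    ultimately have "?f \<subseteq> inside (path_image c) \<longleftrightarrow> \<not> ?f \<subseteq> outside (path_image c)"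
      by (intro inside_or_outside[OF c(1,2)]) simp_all
    then show False using xf yf x y J by blast
  qed
  then show ?thesis using that fg sub x y xD yD by blast
qed

text \<open>
  All faces but the one around the new edge survive, and that one is replaced by two or more
  faces.
\<close>
lemma faces_insert_closing_edge:
  assumes "A \<subseteq> E" "{u, v} \<in> E" "{u, v} \<notin> A" "(u, v) \<in> (linked A)\<^sup>*" "finite (faces A)"
  shows "finite (faces (insert {u, v} A)) \<and> card (faces A) < card (faces (insert {u, v} A))"
proof -
  let ?e = "{u, v}" and ?B = "insert {u, v} A"
  obtain U where U: "U \<in> faces A" "interior_arc ?e \<subseteq> U" using face_around_edge[OF assms(1-3)] by blast
  let ?N = "{f \<in> faces ?B. f \<subseteq> U}"
  have keep: "f \<in> faces ?B" if f: "f \<in> faces A" "f \<noteq> U" for f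
  proof (rule components_intermediate_subset[OF f(1)])
    have "f \<inter> U = {}" using components_nonoverlap[OF f(1) U(1)] f(2) by blast
    then have "f \<inter> interior_arc ?e = {}" using U(2) by blast
    moreover have "pos ` ?e \<subseteq> drawing V A" using edge_subset[OF assms(2)] by (auto simp: drawing_def)
    ultimately show "f \<subseteq> - drawing V ?B"
      using face_props[OF f(1)] interior_arc_props(3)[OF assms(2)] unfolding drawing_insert by blast
    show "- drawing V ?B \<subseteq> - drawing V A" by (auto simp: drawing_insert)
  qed
  have "faces ?B \<subseteq> (faces A - {U}) \<union> ?N"
  proof
    fix f assume f: "f \<in> faces ?B"
    have "f \<subseteq> - drawing V A" using face_props[OF f] by (auto simp: drawing_insert)
    then obtain C where C: "C \<in> faces A" "f \<subseteq> C"
      using exists_component_superset[of f "- drawing V A"] face_props[OF f] by blast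
    show "f \<in> (faces A - {U}) \<union> ?N"
    proof (cases "C = U")
      case True
      then show ?thesis using f C by blast
    next
      case False
      then have "C \<in> faces ?B" using keep C by blast
      then have "f = C" using components_eq[OF f] C(2) face_props[OF f] by blast
      then show ?thesis using C False by blast
    qed
  qed
  then have fin: "finite (faces ?B)"
    using faces_in_face[OF assms(1-3) U(1)] assms(5) by (meson finite_Diff finite_UnI finite_subset)
  obtain f g where fg: "f \<in> faces ?B" "g \<in> faces ?B" "f \<subseteq> U" "g \<subseteq> U" "f \<noteq> g"
    using closing_edge_splits_face[OF assms(1-4) U] by metis
  have new: "h \<notin> faces A - {U}" if "h \<in> faces ?B" "h \<subseteq> U" for h
    using that face_props[OF that(1)] components_nonoverlap[OF _ U(1)] by blast
  have "card (faces A) = Suc (card (faces A - {U}))"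
    using U(1) assms(5) by (simp add: card_Suc_Diff1 del: card_Diff_insert)
  also have "\<dots> < card ({f, g} \<union> (faces A - {U}))"
    using fg new assms(5) by (subst card_Un_disjoint) auto
  also have "\<dots> \<le> card (faces ?B)" using fg keep fin by (intro card_mono) auto
  finally show ?thesis using fin by simp
qed

lemma forest_one_face:
  assumes "A \<subseteq> E" "acyclic_edges A"
  shows "connected (- drawing V A)"
proof -
  have "finite A" using assms(1) finE finite_subset by blast
  then show ?thesis using assms
  proof (induction A rule: finite_induct)
    case empty
    have "path_connected (- (pos ` V))"
      using finV by (intro path_connected_complement_countable) (auto intro: countable_finite)
    then show ?case by (simp add: drawing_def path_connected_imp_connected)
  next
    case (insert e A)
    then have A: "A \<subseteq> E" "e \<in> E" by auto
    have "acyclic_edges A" using insert.prems(2) by (rule acyclic_edges_mono) auto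
    then have con: "connected (- drawing V A)" using insert.IH A by blast
    obtain u v where uv: "e = {u, v}" using graph_edgesE[OF edges A(2)] by metis
    have "insert e A - {{u, v}} = A" using insert.hyps(2) uv by auto
    then have nl: "(u, v) \<notin> (linked A)\<^sup>*"
      using insert.prems(2) uv unfolding acyclic_edges_def by (metis insertI1)
    show ?case unfolding connected_iff_connected_component
    proof (intro ballI)
      fix x y assume xy: "x \<in> - drawing V (insert e A)" "y \<in> - drawing V (insert e A)"
      then have "connected_component (- drawing V A) x y"
        using con by (auto simp: connected_iff_connected_component drawing_insert)
      then show "connected_component (- drawing V (insert e A)) x y"
        using bridge_no_separation[of A u v x y] A insert.hyps(2) nl xy unfolding uv
        by (auto simp: drawing_insert)
    qed
  qed
qed

text \<open>
  If the edges touched by \<open>f\<close> formed a forest, their drawing would have a connected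
  complement. The frontier of \<open>f\<close> is contained in that drawing, so \<open>f\<close> would fill the
  whole complement and leave no room for \<open>g\<close>.
\<close>
lemma touching_cyclic:
  assumes "A \<subseteq> E" "f \<in> faces A" "g \<in> faces A" "f \<noteq> g"
  shows "\<not> acyclic_edges (touching A f)"
proof
  assume ac: "acyclic_edges (touching A f)"
  let ?T = "touching A f"
  have TA: "?T \<subseteq> A" by (auto simp: touching_def)
  have con: "connected (- drawing V ?T)" using forest_one_face[OF _ ac] TA assms(1) by blast
  have AT: "- drawing V A \<subseteq> - drawing V ?T" using TA by (auto simp: drawing_def)
  have "f \<subseteq> - drawing V ?T" "f \<noteq> {}" using face_props[OF assms(2)] AT by blast+
  then have 1: "- drawing V ?T \<inter> f \<noteq> {}" by blast
  obtain y where "y \<in> g" using face_props[OF assms(3)] by blast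
  then have "y \<in> - drawing V ?T" "y \<notin> f"
    using face_props[OF assms(3)] AT components_nonoverlap[OF assms(2,3)] assms(4) by blast+
  then have "- drawing V ?T - f \<noteq> {}" by blast
  from connected_Int_frontier[OF con 1 this] obtain p where
    p: "p \<in> frontier f" "p \<notin> drawing V ?T" by blast
  have pf: "p \<notin> f" using p(1) open_face[OF assms(1,2)] by (auto simp: frontier_def interior_open)
  have pcl: "p \<in> closure f" using p(1) by (auto simp: frontier_def)
  have "p \<in> drawing V A"
  proof (rule ccontr)
    assume "p \<notin> drawing V A"
    then have pD: "p \<in> - drawing V A" by simp
    then obtain h where h: "h \<in> faces A" "p \<in> h" using Union_components by blast
    then have "h \<inter> f \<noteq> {}"
      using open_Int_closure_eq_empty[OF open_face[OF assms(1) h(1)]] pcl by blast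
    then have "h = f" using components_eq[OF h(1) assms(2)] by blast
    then show False using h pf by blast
  qed
  then obtain e where e: "e \<in> A" "p \<in> path_image (crv e)" "p \<notin> pos ` V"
    using p(2) by (auto simp: drawing_def)
  then have "p \<in> interior_arc e" using edge_subset assms(1) by (auto simp: interior_arc_def)
  then have "e \<in> ?T" using e pcl by (auto simp: touching_def)
  then show False using p(2) e by (auto simp: drawing_def)
qed

text \<open>
  The half of Euler's formula that is needed: a spanning forest has one face, and every other edge
  adds one.
\<close>
lemma face_count:
  assumes "T \<subseteq> E" "acyclic_edges T"
    and max: "\<And>u v. {u, v} \<in> E \<Longrightarrow> (u, v) \<in> (linked T)\<^sup>*"
  shows "finite (faces E) \<and> Suc (card E) \<le> card T + card (faces E)"
proof -
  have finT: "finite T" using assms(1) finE finite_subset by blast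
  have "finite (faces (T \<union> B)) \<and> Suc (card B) \<le> card (faces (T \<union> B))"
    if "finite B" "B \<subseteq> E - T" for B
    using that
  proof (induction B rule: finite_induct)
    case empty
    have "bounded (drawing V T)" using compact_drawing assms(1) finV compact_imp_bounded by blast
    then have "- drawing V T \<noteq> {}" using not_bounded_UNIV by (metis Compl_empty_eq double_compl)
    then have "faces T = {- drawing V T}"
      using forest_one_face[OF assms(1,2)] by (simp add: components_eq_sing_iff)
    then show ?case by simp
  next
    case (insert e B)
    then have e: "e \<in> E" "e \<notin> T \<union> B" and B: "T \<union> B \<subseteq> E" using assms(1) by auto
    obtain u v where uv: "e = {u, v}" using graph_edgesE[OF edges e(1)] by metis
    have "(u, v) \<in> (linked (T \<union> B))\<^sup>*"
      using max e(1) uv linked_mono[of T "T \<union> B"] by blast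
    then have "finite (faces (insert e (T \<union> B)))
        \<and> card (faces (T \<union> B)) < card (faces (insert e (T \<union> B)))"
      using faces_insert_closing_edge[of "T \<union> B" u v] insert B e uv by auto
    then show ?case using insert by auto
  qed
  from this[of "E - T"] have "finite (faces E) \<and> Suc (card (E - T)) \<le> card (faces E)"
    using finE assms(1) by (simp add: Un_absorb1)
  moreover have "card E = card T + card (E - T)"
    using finT finE assms(1) card_mono[OF finE assms(1)] by (simp add: card_Diff_subset)
  ultimately show ?thesis by simp
qed

text \<open>
  Every face touches at least \<open>g\<close> edges and every edge touches at most two faces. Combined
  with \<open>face_count\<close> for a maximal forest, which has fewer edges than there are vertices, this
  bounds the number of edges. If there is only one face, the graph itself is a forest.
\<close>
theorem girth_edge_bound:
  assumes "V \<noteq> {}" and g: "2 \<le> g" and girth: "\<And>ws. cycle_verts E ws \<Longrightarrow> g \<le> length ws"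
  shows "(g - 2) * card E + g \<le> g * card V"
proof -
  have "\<exists>T. (T \<subseteq> E \<and> acyclic_edges T) \<and> (\<forall>S. S \<subseteq> E \<and> acyclic_edges S \<longrightarrow> card S \<le> card T)"
    using card_mono[OF finE]
    by (intro ex_has_greatest_nat[where k = "{}" and b = "Suc (card E)"])
       (simp_all add: acyclic_edges_def le_SucI less_Suc_eq_le)
  then obtain T where T: "T \<subseteq> E" "acyclic_edges T"
    and maxT: "\<And>S. S \<subseteq> E \<Longrightarrow> acyclic_edges S \<Longrightarrow> card S \<le> card T" by blast
  have finT: "finite T" using T finE finite_subset by blast
  have max: "(u, v) \<in> (linked T)\<^sup>*" if "{u, v} \<in> E" for u v
  proof (rule ccontr)
    assume n: "(u, v) \<notin> (linked T)\<^sup>*"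
    then have "{u, v} \<notin> T" by (auto simp: linked_def)
    then show False using maxT[of "insert {u, v} T"] acyclic_edges_insert[OF T(2) n] T(1) that finT
      by simp
  qed
  have fc: "finite (faces E)" "Suc (card E) \<le> card T + card (faces E)"
    using face_count[OF T max] by blast+
  have cT: "card T < card V"
    using card_forest[OF finV assms(1) _ T(2)] graph_edges_subset[OF edges T(1)] T(1) edge_subset
    by blast
  show ?thesis
  proof (cases "card (faces E) \<le> 1")
    case True
    then have "card E < card V" using fc cT by linarith
    then have "g * card E + g \<le> g * card V" by (metis Suc_leI mult_Suc_right mult_le_mono2 add.commute)
    then show ?thesis by (simp add: diff_mult_distrib)
  next
    case False
    have len: "g \<le> card (touching E f)" if f: "f \<in> faces E" for f
    proof -
      obtain h where h: "h \<in> faces E" "f \<noteq> h"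
      proof -
        have "\<not> faces E \<subseteq> {f}" using False card_mono[of "{f}" "faces E"] by auto
        then show ?thesis using that by blast
      qed
      have TE: "touching E f \<subseteq> E" by (auto simp: touching_def)
      have "graph_edges V (touching E f)"
        using graph_edges_subset[OF edges TE] TE edge_subset by blast
      from cyclic_edges_card[OF this finV touching_cyclic[OF order_refl f h]]
      obtain ws where ws: "cycle_verts (touching E f) ws" "length ws \<le> card (touching E f)" by blast
      have "cycle_verts E ws" using ws(1) TE unfolding cycle_verts_def
        by (auto elim: successively_mono)
      then show ?thesis using girth ws(2) by (meson le_trans)
    qed
    have "g * card (faces E) \<le> (\<Sum>f\<in>faces E. card (touching E f))"
      using sum_mono[of "faces E" "\<lambda>_. g" "\<lambda>f. card (touching E f)"] len
      by (simp add: mult.commute)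
    also have "\<dots> = (\<Sum>f\<in>faces E. \<Sum>e | e \<in> E \<and> e \<in> touching E f. 1)"
    proof (intro sum.cong refl)
      fix f
      have "{e. e \<in> E \<and> e \<in> touching E f} = touching E f" by (auto simp: touching_def)
      then show "card (touching E f) = (\<Sum>e | e \<in> E \<and> e \<in> touching E f. 1)" by simp
    qed
    also have "\<dots> = (\<Sum>e\<in>E. \<Sum>f | f \<in> faces E \<and> e \<in> touching E f. 1)"
      by (rule sum.swap_restrict[OF fc(1) finE])
    also have "\<dots> = (\<Sum>e\<in>E. card {f \<in> faces E. e \<in> touching E f})" by simp
    also have "\<dots> \<le> (\<Sum>e\<in>E. 2)" using edge_touches_two_faces[OF order_refl] by (intro sum_mono) blast
    finally have "g * card (faces E) \<le> 2 * card E" by simp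
    moreover have "g * (card E + 2) \<le> g * (card V + card (faces E))"
      using fc(2) cT by (intro mult_le_mono2) linarith
    ultimately have "g * card E + 2 * g \<le> g * card V + 2 * card E" by (simp add: algebra_simps)
    then show ?thesis using g by (simp add: diff_mult_distrib)
  qed
qed

end

section \<open>Colouring the surroundings of a vertex\<close>

lemma greedy_injection:
  assumes "finite A" "\<And>a. a \<in> A \<Longrightarrow> finite (M a) \<and> card A \<le> card (M a)"
  shows "\<exists>\<alpha>. inj_on \<alpha> A \<and> (\<forall>a\<in>A. \<alpha> a \<in> M a)"
  using assms
proof (induction A rule: finite_induct)
  case (insert a A)
  then obtain \<alpha> where \<alpha>: "inj_on \<alpha> A" "\<forall>a\<in>A. \<alpha> a \<in> M a" by fastforce
  have "card (\<alpha> ` A) < card (M a)"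
    using insert.prems[of a] insert.hyps card_image_le[OF insert.hyps(1), of \<alpha>] by simp
  then have "\<not> M a \<subseteq> \<alpha> ` A"
    using insert.hyps(1) by (meson card_mono finite_imageI not_less)
  then obtain c where c: "c \<in> M a" "c \<notin> \<alpha> ` A" by blast
  have "inj_on (\<alpha>(a := c)) (insert a A)" using \<alpha>(1) c(2) insert.hyps(2)
    by (auto simp: inj_on_def)
  moreover have "\<forall>b\<in>insert a A. (\<alpha>(a := c)) b \<in> M b" using \<alpha>(2) c insert.hyps(2) by auto
  ultimately show ?case by blast
qed auto

lemma ex_diff: 
  assumes "finite F" "card F < card M"
  shows "\<exists>c. c \<in> M \<and> c \<notin> F"
proof (rule ccontr)
  assume "\<not> ?thesis"
  then have "card M \<le> card F" using assms(1) by (intro card_mono) auto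
  with assms(2) show False by simp
qed

text \<open>
  The elements of \<open>A\<close> play the neighbours of a vertex of colour \<open>c\<close>, and \<open>D\<close>
  contains the colours that are left for them. Each neighbour \<open>a\<close> has a further neighbour
  that gets a colour \<open>\<beta> a\<close> from the list \<open>L a\<close>, and \<open>a\<close> itself must also
  avoid the set \<open>Q a\<close>. There may be only one colour more in \<open>D\<close> than there are
  neighbours, so the greedy method gets stuck at the last two. These are \<open>a1\<close> and
  \<open>a2\<close>, and three colours remain for them. If \<open>Q a2\<close> has at most one element, then at
  most two of the three are excluded for \<open>a2\<close>. Otherwise a colour outside \<open>Q a2\<close> is
  taken, and the long list \<open>L a2\<close> allows \<open>\<beta> a2\<close> to be chosen after it. Of the other two
  colours \<open>Q a1\<close> excludes at most one, as \<open>c\<close> is not among them, and again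
  \<open>\<beta> a1\<close> is chosen last.
\<close>
lemma choose_hub_colours:
  fixes D :: "'c set"
  assumes finA: "finite A" and a12: "a1 \<in> A" "a2 \<in> A" "a1 \<noteq> a2"
    and D: "finite D" "c \<notin> D" "Suc (card A) \<le> card D"
    and finQ: "\<And>a. a \<in> A \<Longrightarrow> finite (Q a)"
    and lists: "\<And>a. a \<in> A \<Longrightarrow>
      card (Q a) \<le> 1 \<and> L a - {c} \<noteq> {} \<or> card (Q a) \<le> 2 \<and> 3 \<le> card (L a)"
    and a1: "card (Q a1 - {c}) \<le> 1" "2 \<le> card (L a1 - {c})"
  shows "\<exists>\<alpha> \<beta>. inj_on \<alpha> A \<and>
    (\<forall>a\<in>A. \<alpha> a \<in> D \<and> \<beta> a \<in> L a \<and> \<beta> a \<noteq> c \<and> \<alpha> a \<noteq> \<beta> a \<and> \<alpha> a \<notin> Q a)"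
proof -
  have ex: "\<exists>b. b \<in> L a \<and> b \<noteq> c" if "a \<in> A" for a
    using lists[OF that]
  proof
    assume "card (Q a) \<le> 2 \<and> 3 \<le> card (L a)"
    then show ?thesis using ex_diff[of "{c}" "L a"] by auto
  qed auto
  then obtain \<beta>0 where \<beta>0: "\<And>a. a \<in> A \<Longrightarrow> \<beta>0 a \<in> L a \<and> \<beta>0 a \<noteq> c" by metis
  let ?A = "A - {a1, a2}"
  have cardA: "card A = card ?A + 2"
  proof -
    have "A = insert a1 (insert a2 ?A)" using a12 by auto
    then have "card A = card (insert a1 (insert a2 ?A))" by (rule arg_cong)
    also have "\<dots> = card ?A + 2" using a12(3) finA by (simp del: insert_Diff_single)
    finally show ?thesis .
  qed
  have "\<exists>\<alpha>. inj_on \<alpha> ?A \<and> (\<forall>a\<in>?A. \<alpha> a \<in> D - insert (\<beta>0 a) (Q a))"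
  proof (rule greedy_injection)
    fix a assume a: "a \<in> ?A"
    have "card (insert (\<beta>0 a) (Q a)) \<le> 3"
      using lists[of a] a finQ[of a] card_insert_le_m1[of 3 "Q a"] by (auto simp: card_insert_if)
    then have "card D - 3 \<le> card (D - insert (\<beta>0 a) (Q a))"
      using diff_card_le_card_Diff[of "insert (\<beta>0 a) (Q a)" D] finQ[of a] a by simp
    then show "finite (D - insert (\<beta>0 a) (Q a)) \<and> card ?A \<le> card (D - insert (\<beta>0 a) (Q a))"
      using D cardA by simp
  qed (use finA in simp)
  then obtain \<alpha>0 where \<alpha>0: "inj_on \<alpha>0 ?A" "\<And>a. a \<in> ?A \<Longrightarrow> \<alpha>0 a \<in> D - insert (\<beta>0 a) (Q a)" by blast
  define R where "R = D - \<alpha>0 ` ?A"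
  have cR: "3 \<le> card R"
    unfolding R_def using diff_card_le_card_Diff[of "\<alpha>0 ` ?A" D] finA D cardA
      card_image_le[of ?A \<alpha>0] by simp
  have cR': "c \<notin> R" using D(2) by (simp add: R_def)
  \<comment> \<open>The colours of \<open>R\<close> are left over for \<open>a1\<close> and \<open>a2\<close>.\<close>
  have "\<exists>\<rho> \<beta>. \<rho> \<in> R \<and> \<beta> \<in> L a2 \<and> \<beta> \<noteq> c \<and> \<rho> \<noteq> \<beta> \<and> \<rho> \<notin> Q a2"
    using lists[OF a12(2)]
  proof
    assume "card (Q a2) \<le> 1 \<and> L a2 - {c} \<noteq> {}"
    moreover have "finite (insert (\<beta>0 a2) (Q a2))" using finQ a12 by simp
    ultimately have "\<exists>\<rho>. \<rho> \<in> R \<and> \<rho> \<notin> insert (\<beta>0 a2) (Q a2)"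
      using cR finQ[OF a12(2)] by (intro ex_diff) (auto simp: card_insert_if)
    then show ?thesis using \<beta>0[OF a12(2)] by blast
  next
    assume *: "card (Q a2) \<le> 2 \<and> 3 \<le> card (L a2)"
    then obtain \<rho> where \<rho>: "\<rho> \<in> R" "\<rho> \<notin> Q a2" using ex_diff[of "Q a2" R] cR finQ a12 by fastforce
    have "card {c, \<rho>} \<le> 2" by (simp add: card_insert_if)
    then obtain \<beta> where "\<beta> \<in> L a2" "\<beta> \<notin> {c, \<rho>}" using ex_diff[of "{c, \<rho>}" "L a2"] * by force
    then show ?thesis using \<rho> by blast
  qed
  then obtain \<rho> \<beta>2 where two: "\<rho> \<in> R" "\<beta>2 \<in> L a2" "\<beta>2 \<noteq> c" "\<rho> \<noteq> \<beta>2" "\<rho> \<notin> Q a2" by blast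
  have "card (insert \<rho> (Q a1 - {c})) < card R"
    using a1(1) cR finQ[OF a12(1)] by (auto simp: card_insert_if)
  then obtain \<sigma> where \<sigma>: "\<sigma> \<in> R" "\<sigma> \<noteq> \<rho>" "\<sigma> \<notin> Q a1 - {c}"
    using ex_diff[of "insert \<rho> (Q a1 - {c})" R] finQ[OF a12(1)] by auto
  \<comment> \<open>The further neighbour of \<open>a1\<close> adapts to \<open>\<sigma>\<close>: its list has two colours besides \<open>c\<close>.\<close>
  obtain \<beta>1 where \<beta>1: "\<beta>1 \<in> L a1" "\<beta>1 \<noteq> c" "\<beta>1 \<noteq> \<sigma>" using ex_diff[of "{\<sigma>}" "L a1 - {c}"] a1(2) by auto
  have \<sigma>Q: "\<sigma> \<notin> Q a1" using \<sigma> cR' by blast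
  define \<alpha> where "\<alpha> = \<alpha>0(a1 := \<sigma>, a2 := \<rho>)"
  define \<beta> where "\<beta> = \<beta>0(a1 := \<beta>1, a2 := \<beta>2)"
  have fresh: "\<sigma> \<noteq> \<alpha>0 a" "\<rho> \<noteq> \<alpha>0 a" if "a \<in> ?A" for a
    using that \<sigma>(1) two(1) by (auto simp: R_def)
  have "inj_on \<alpha> A"
  proof (rule inj_onI)
    fix a b assume "a \<in> A" "b \<in> A" "\<alpha> a = \<alpha> b"
    then show "a = b"
      using fresh[of a] fresh[of b] inj_onD[OF \<alpha>0(1), of a b] a12(3) \<sigma>(2)
      by (cases "a = a1"; cases "a = a2"; cases "b = a1"; cases "b = a2") (simp_all add: \<alpha>_def)
  qed
  moreover have "\<forall>a\<in>A. \<alpha> a \<in> D \<and> \<beta> a \<in> L a \<and> \<beta> a \<noteq> c \<and> \<alpha> a \<noteq> \<beta> a \<and> \<alpha> a \<notin> Q a"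
  proof
    fix a assume a: "a \<in> A"
    show "\<alpha> a \<in> D \<and> \<beta> a \<in> L a \<and> \<beta> a \<noteq> c \<and> \<alpha> a \<noteq> \<beta> a \<and> \<alpha> a \<notin> Q a"
      using a \<alpha>0(2)[of a] \<beta>0[OF a] \<beta>1 \<sigma>(1) \<sigma>Q two a12(3)
      by (cases "a = a1"; cases "a = a2") (simp_all add: \<alpha>_def \<beta>_def R_def)
  qed
  ultimately show ?thesis by blast
qed

section \<open>Minimal uncolourable vertex sets\<close>

text \<open>
  Two vertices of \<open>X\<close> are coloured apart on account of a common neighbour only if that
  neighbour belongs to \<open>X\<close>, so this is a property of the induced subgraph.
\<close>
definition proper_colouring :: "('a \<Rightarrow> 'a \<Rightarrow> bool) \<Rightarrow> 'c set \<Rightarrow> 'a set \<Rightarrow> ('a \<Rightarrow> 'c) \<Rightarrow> bool" where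
  "proper_colouring adj K X \<phi> \<longleftrightarrow> \<phi> ` X \<subseteq> K \<and>
     (\<forall>x\<in>X. \<forall>y\<in>X. x \<noteq> y \<and> (adj x y \<or> (\<exists>z\<in>X. adj x z \<and> adj z y)) \<longrightarrow> \<phi> x \<noteq> \<phi> y)"

text \<open>
  Cycles are excluded and degrees are counted inside \<open>X\<close>, while \<open>k\<close> only bounds these
  degrees, so that it can be the maximum degree of a larger graph.
\<close>
locale critical_graph =
  fixes adj :: "'a \<Rightarrow> 'a \<Rightarrow> bool" and X :: "'a set" and K :: "'c set" and k :: nat
  assumes sym: "adj u v \<Longrightarrow> adj v u" and irrefl: "\<not> adj v v"
    and girth: "\<And>ws. 3 \<le> length ws \<Longrightarrow> distinct ws \<Longrightarrow> set ws \<subseteq> X \<Longrightarrow> successively adj ws \<Longrightarrow>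
      adj (last ws) (hd ws) \<Longrightarrow> 7 \<le> length ws"
    and finX: "finite X"
    and degree: "v \<in> X \<Longrightarrow> card {u \<in> X. adj v u} \<le> k"
    and k: "10 \<le> k" and cardK: "card K = k + 2"
    and uncolourable: "\<not> proper_colouring adj K X \<phi>"
    and minimal: "Y \<subset> X \<Longrightarrow> \<exists>\<phi>. proper_colouring adj K Y \<phi>"
begin

definition N :: "'a \<Rightarrow> 'a set" where "N v = {u \<in> X. adj v u}"
definition d :: "'a \<Rightarrow> nat" where "d v = card (N v)"

lemma finN [simp, intro]: "finite (N v)" using finX by (simp add: N_def)
lemma N_sym: "u \<in> X \<Longrightarrow> v \<in> N u \<Longrightarrow> u \<in> N v" using sym by (auto simp: N_def)
lemma N_sub: "v \<in> N u \<Longrightarrow> v \<in> X" by (simp add: N_def)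
lemma N_irr: "v \<notin> N v" using irrefl by (simp add: N_def)
lemma d_le: "v \<in> X \<Longrightarrow> d v \<le> k" using degree by (simp add: d_def N_def)
lemma finK: "finite K" using cardK by (metis add_2_eq_Suc' card.infinite nat.distinct(1))

lemma no_triangle: "a \<in> X \<Longrightarrow> b \<in> N a \<Longrightarrow> c \<in> N b \<Longrightarrow> a \<in> N c \<Longrightarrow> False"
  using girth[of "[a, b, c]"] irrefl by (auto simp: N_def)

lemma no_4cycle: "b \<in> N a \<Longrightarrow> c \<in> N b \<Longrightarrow> e \<in> N c \<Longrightarrow> a \<in> N e \<Longrightarrow> a = c \<or> b = e"
  using girth[of "[a, b, c, e]"] irrefl by (auto simp: N_def)

lemma no_5cycle: "distinct [a, b, c, e, f] \<Longrightarrow> b \<in> N a \<Longrightarrow> c \<in> N b \<Longrightarrow> e \<in> N c \<Longrightarrow> f \<in> N e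
    \<Longrightarrow> a \<in> N f \<Longrightarrow> False"
  using girth[of "[a, b, c, e, f]"] by (auto simp: N_def)

lemma no_6cycle: "distinct [a, b, c, e, f, g] \<Longrightarrow> b \<in> N a \<Longrightarrow> c \<in> N b \<Longrightarrow> e \<in> N c \<Longrightarrow> f \<in> N e
    \<Longrightarrow> g \<in> N f \<Longrightarrow> a \<in> N g \<Longrightarrow> False"
  using girth[of "[a, b, c, e, f, g]"] by (auto simp: N_def)

text \<open>
  The vertices that restrict the colour of \<open>v\<close> through the neighbours in \<open>P\<close>. With
  \<open>P = N v\<close> these are all vertices at distance 1 or 2.
\<close>
definition near_via :: "'a set \<Rightarrow> 'a \<Rightarrow> 'a set" where
  "near_via P v = (\<Union>p\<in>P. insert p (N p - {v}))"

lemma finite_near_via: "P \<subseteq> N v \<Longrightarrow> finite (near_via P v)"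
  unfolding near_via_def using finite_subset[of P "N v"] by auto

lemma card_near_via:
  assumes "v \<in> X" "P \<subseteq> N v"
  shows "card (near_via P v) \<le> (\<Sum>p\<in>P. d p)"
proof -
  have fin: "finite P" using assms(2) finite_subset by blast
  have "card (near_via P v) \<le> (\<Sum>p\<in>P. card (insert p (N p - {v})))"
    unfolding near_via_def using fin by (rule card_UN_le)
  also have "\<dots> \<le> (\<Sum>p\<in>P. d p)"
  proof (rule sum_mono)
    fix p assume "p \<in> P"
    then have v: "v \<in> N p" using assms N_sym by blast
    have "card (insert p (N p - {v})) \<le> Suc (card (N p - {v}))" by (rule card_insert_le_m1) auto
    also have "\<dots> = d p" unfolding d_def using v by (metis card_Suc_Diff1 finN)
    finally show "card (insert p (N p - {v})) \<le> d p" .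
  qed
  finally show ?thesis .
qed

text \<open>
  The way in which minimality is used. Delete \<open>D\<close>, colour the rest, and change the colours
  on \<open>S\<close>. If a deleted vertex is adjacent to at most one vertex that keeps its old colour, no
  conflict between old colours is created by putting it back.
\<close>
lemma recolour:
  assumes \<phi>: "proper_colouring adj K (X - D) \<phi>" and DS: "D \<subseteq> S"
    and K: "\<And>x. x \<in> S \<Longrightarrow> \<psi> x \<in> K"
    and S: "\<And>s z. s \<in> S \<Longrightarrow> s \<in> X \<Longrightarrow> z \<in> near_via (N s) s \<Longrightarrow> \<psi> s \<noteq> \<psi> z"
    and old: "\<And>z. z \<in> X - S \<Longrightarrow> \<psi> z = \<phi> z"
    and D: "\<And>x y y'. x \<in> D \<Longrightarrow> y \<in> N x - S \<Longrightarrow> y' \<in> N x - S \<Longrightarrow> y = y'"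
  shows False
proof -
  have nearI: "y \<in> near_via (N x) x"
    if "x \<in> X" "y \<in> X" "x \<noteq> y" "adj x y \<or> (\<exists>z\<in>X. adj x z \<and> adj z y)" for x y
    using that by (auto simp: near_via_def N_def)
  have "proper_colouring adj K X \<psi>"
    unfolding proper_colouring_def
  proof (intro conjI ballI impI)
    show "\<psi> ` X \<subseteq> K"
    proof (intro image_subsetI)
      fix x assume "x \<in> X"
      show "\<psi> x \<in> K"
      proof (cases "x \<in> S")
        case True then show ?thesis by (rule K)
      next
        case False
        then have "\<psi> x = \<phi> x" "x \<in> X - D" using old DS \<open>x \<in> X\<close> by auto
        then show ?thesis using \<phi> by (auto simp: proper_colouring_def)
      qed
    qed
    fix x y assume x: "x \<in> X" and y: "y \<in> X" and xy: "x \<noteq> y \<and> (adj x y \<or> (\<exists>z\<in>X. adj x z \<and> adj z y))"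
    then have yx: "y \<noteq> x" "adj y x \<or> (\<exists>z\<in>X. adj y z \<and> adj z x)" using sym by blast+
    show "\<psi> x \<noteq> \<psi> y"
    proof (cases "x \<in> S \<or> y \<in> S")
      case True
      then show ?thesis
      proof
        assume "x \<in> S"
        then show ?thesis using S[OF _ x nearI[OF x y]] xy by blast
      next
        assume "y \<in> S"
        then have "\<psi> y \<noteq> \<psi> x" using S[OF _ y nearI[OF y x]] yx by blast
        then show ?thesis by simp
      qed
    next
      case False
      then have D': "x \<in> X - D" "y \<in> X - D" using x y DS by auto
      have "adj x y \<or> (\<exists>z\<in>X-D. adj x z \<and> adj z y)"
      proof (rule ccontr)
        assume n: "\<not> ?thesis"
        then obtain z where z: "z \<in> D" "z \<in> X" "adj x z" "adj z y" using xy by blast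
        then have "x \<in> N z - S" "y \<in> N z - S" using x y False sym by (auto simp: N_def)
        then show False using D[OF z(1)] xy by blast
      qed
      then have "\<phi> x \<noteq> \<phi> y" using \<phi> D' xy unfolding proper_colouring_def by blast
      then show ?thesis using old x y False by auto
    qed
  qed
  then show False using uncolourable by blast
qed

lemma free_colour:
  assumes "finite F" "card F \<le> k + 1"
  obtains c where "c \<in> K" "c \<notin> \<phi> ` F"
  using ex_diff[of "\<phi> ` F" K] card_image_le[OF assms(1), of \<phi>] assms cardK by auto

lemma min_degree: 
  assumes "v \<in> X" shows "2 \<le> d v"
proof (rule ccontr)
  assume "\<not> 2 \<le> d v"
  then have dv: "card (N v) \<le> 1" by (simp add: d_def)
  have "(\<Sum>u\<in>N v. d u) \<le> card (N v) * k"
    using sum_bounded_above[of "N v" d k] d_le N_sub by simp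
  also have "\<dots> \<le> k" using dv by simp
  finally have c: "card (near_via (N v) v) \<le> k + 1" using card_near_via[OF assms order_refl] by simp
  obtain \<phi> where \<phi>: "proper_colouring adj K (X - {v}) \<phi>" using minimal[of "X - {v}"] assms by blast
  obtain c where c: "c \<in> K" "c \<notin> \<phi> ` near_via (N v) v"
    using free_colour[OF finite_near_via[OF order_refl] c] .
  show False
  proof (rule recolour[OF \<phi>, of "{v}" "\<phi>(v := c)"])
    fix s z assume "s \<in> {v}" "z \<in> near_via (N s) s"
    moreover have "v \<notin> near_via (N v) v" using N_irr by (auto simp: near_via_def)
    ultimately show "(\<phi>(v := c)) s \<noteq> (\<phi>(v := c)) z" using c(2) by auto
  next
    fix x y y' assume "x \<in> {v}" "y \<in> N x - {v}" "y' \<in> N x - {v}"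
    then show "y = y'" using dv card_le_Suc0_iff_eq[OF finN, of v] by auto
  qed (use c in auto)
qed

text \<open>
  Delete \<open>v\<close>, colour the rest and discard the colour of \<open>b\<close>. The sum of the degrees of
  \<open>b\<close> and \<open>y\<close> leaves a colour for \<open>v\<close>. If the other neighbours of \<open>b\<close> had
  small degrees, at least two colours would remain for \<open>b\<close>, and one of them differs from the
  colour of \<open>v\<close>.
\<close>
lemma two_vertex_weight:
  assumes v: "v \<in> X" "N v = {b, y}" "b \<noteq> y" and sum: "d b + d y \<le> k + 2"
  shows "k \<le> (\<Sum>p\<in>N b - {v}. d p)"
proof (rule ccontr)
  assume "\<not> ?thesis"
  then have light: "(\<Sum>p\<in>N b - {v}. d p) \<le> k - 1" by simp
  have bX: "b \<in> X" "y \<in> X" using v(2) by (auto simp: N_def)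
  have vb: "v \<in> N b" "v \<in> N y" using N_sym[OF v(1)] v(2) by auto
  have vby: "v \<noteq> b" "v \<noteq> y" using N_irr[of v] v(2) by auto
  obtain \<phi> where \<phi>: "proper_colouring adj K (X - {v}) \<phi>" using minimal[of "X - {v}"] v(1) by blast
  let ?F = "insert y (N y - {v}) \<union> (N b - {v})"
  have "card ?F \<le> Suc (card (N y - {v})) + card (N b - {v})"
    using card_Un_le[of "insert y (N y - {v})" "N b - {v}"]
      card_insert_le_m1[of "Suc (card (N y - {v}))" "N y - {v}" y] by simp
  also have "\<dots> \<le> k + 1"
  proof -
    have "Suc (card (N y - {v})) = d y" "Suc (card (N b - {v})) = d b"
      unfolding d_def using vb by (metis card_Suc_Diff1 finN)+
    then show ?thesis using sum by simp
  qed
  finally obtain cv where cv: "cv \<in> K" "cv \<notin> \<phi> ` ?F" using free_colour[of ?F \<phi>] by auto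
  let ?G = "near_via (N b - {v}) b"
  have "card ({cv, \<phi> y} \<union> \<phi> ` ?G) \<le> card {cv, \<phi> y} + card (\<phi> ` ?G)" by (rule card_Un_le)
  also have "\<dots> \<le> 2 + (k - 1)"
  proof (rule add_mono)
    show "card {cv, \<phi> y} \<le> 2" by (simp add: card_insert_if)
    show "card (\<phi> ` ?G) \<le> k - 1"
      using card_image_le[of ?G \<phi>] finite_near_via[of "N b - {v}" b]
        card_near_via[OF bX(1), of "N b - {v}"] light by auto
  qed
  also have "\<dots> < card K" using k cardK by simp
  finally obtain cb where cb: "cb \<in> K" "cb \<notin> {cv, \<phi> y} \<union> \<phi> ` ?G"
    using ex_diff[of "{cv, \<phi> y} \<union> \<phi> ` ?G" K] finite_near_via[of "N b - {v}" b] by auto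
  let ?\<psi> = "\<phi>(v := cv, b := cb)"
  show False
  proof (rule recolour[OF \<phi>, of "{v, b}" ?\<psi>])
    fix s z assume "s \<in> {v, b}" and z: "z \<in> near_via (N s) s"
    then consider "s = v" | "s = b" by blast
    then show "?\<psi> s \<noteq> ?\<psi> z"
    proof cases
      case 1
      then have "z \<in> {b} \<union> ?F" "z \<noteq> v" using z v(2) N_irr[of v] vby by (auto simp: near_via_def)
      then show ?thesis using 1 cv(2) cb(2) vby by auto
    next
      case 2
      then have "z \<in> insert v (insert y ?G)" "z \<noteq> b"
        using z v(2) N_irr[of b] by (auto simp: near_via_def)
      moreover have "y \<noteq> b" using v(3) by simp
      ultimately show ?thesis using 2 cb(2) vby by (auto split: if_splits)
    qed
  next
    fix x p p' assume "x \<in> {v}" "p \<in> N x - {v, b}" "p' \<in> N x - {v, b}"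
    then show "p = p'" using v(2) by auto
  qed (use cv cb in auto)
qed

subsection \<open>Vertices of maximum degree\<close>

text \<open>
  The other neighbour of \<open>a\<close>, for a neighbour \<open>a\<close> of \<open>x\<close> of degree 2.
\<close>
definition far :: "'a \<Rightarrow> 'a \<Rightarrow> 'a" where
  "far x a = the_elem (N a - {x})"

definition beyond :: "'a \<Rightarrow> 'a \<Rightarrow> 'a set" where
  "beyond x a = N (far x a) - {a}"

text \<open>
  The needy neighbours of \<open>x\<close> are of two kinds. In a chain two vertices of degree 2 follow
  each other. In a twig the second vertex has degree 3, and its further neighbours have degrees
  2 and 2 or 2 and 3. When a second vertex is recoloured it can choose between two colours in a
  chain and between many colours in a twig.
\<close>
definition chains :: "'a \<Rightarrow> 'a set" where
  "chains x = {a \<in> N x. d a = 2 \<and> d (far x a) = 2}"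

definition twigs :: "'a \<Rightarrow> 'a set" where
  "twigs x = {a \<in> N x. d a = 2 \<and> d (far x a) = 3 \<and> (\<Sum>p\<in>beyond x a. d p) \<le> 5}"

definition soft :: "'a \<Rightarrow> 'a set" where "soft x = chains x \<union> twigs x"
definition stiff :: "'a \<Rightarrow> 'a set" where "stiff x = N x - soft x"

lemma N_two:
  assumes "x \<in> X" "a \<in> N x" "d a = 2"
  shows "N a = {x, far x a}" "far x a \<noteq> x" "far x a \<in> X" "a \<in> N (far x a)" "far x a \<noteq> a"
proof -
  have x: "x \<in> N a" using assms N_sym by blast
  then have "card (N a - {x}) = 1" using assms(3) by (simp add: d_def)
  then obtain b where b: "N a - {x} = {b}" by (rule card_1_singletonE)
  then have "far x a = b" by (simp add: far_def)
  moreover have "N a = {x, b}" "b \<noteq> x" using b x by auto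
  ultimately show 1: "N a = {x, far x a}" "far x a \<noteq> x" by auto
  have bN: "far x a \<in> N a" using 1(1) by blast
  then show "far x a \<in> X" "a \<in> N (far x a)" using N_sub N_sym[OF N_sub[OF assms(2)]] by blast+
  show "far x a \<noteq> a" using bN N_irr[of a] by metis
qed

lemma soft_N: "a \<in> soft x \<Longrightarrow> a \<in> N x \<and> d a = 2"
  by (auto simp: soft_def chains_def twigs_def)

text \<open>
  No cycle of length 3 to 6 passes through \<open>x\<close>, so the vertices up to distance 3 from \<open>x\<close>
  on the branches that start with a vertex of degree 2 form a tree, and the second vertices of
  different branches have no common neighbour.
\<close>
lemma hub_layers:
  assumes x: "x \<in> X" and a: "a \<in> N x" "d a = 2"
  shows "far x a \<notin> N x"
    and "a' \<in> N x \<Longrightarrow> d a' = 2 \<Longrightarrow> far x a = far x a' \<Longrightarrow> a = a'"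
    and "p \<in> beyond x a \<Longrightarrow> p \<noteq> x \<and> p \<notin> N x"
    and "p \<in> beyond x a \<Longrightarrow> a' \<in> N x \<Longrightarrow> d a' = 2 \<Longrightarrow> p \<noteq> far x a'"
    and "p \<in> beyond x a \<Longrightarrow> z \<in> N p - {far x a} \<Longrightarrow> z \<noteq> x \<and> z \<notin> N x"
    and "p \<in> beyond x a \<Longrightarrow> z \<in> N p - {far x a} \<Longrightarrow> a' \<in> N x \<Longrightarrow> d a' = 2 \<Longrightarrow> z \<noteq> far x a'"
    and "w \<in> N x \<Longrightarrow> w \<noteq> a \<Longrightarrow> far x a \<notin> N w"
proof -
  note b = N_two[OF x a]
  have aX: "a \<in> X" using a N_sub by blast
  have xa: "x \<in> N a" and ba: "far x a \<in> N a" using b(1) by auto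
  show 1: "far x a \<notin> N x"
  proof
    assume "far x a \<in> N x"
    then show False using no_triangle[OF aX ba] N_sym x xa a(1) by blast
  qed
  show 4: "far x a \<notin> N w" if w: "w \<in> N x" "w \<noteq> a" for w
  proof
    assume "far x a \<in> N w"
    then have "w \<in> N (far x a)" "x \<in> N w" using w N_sym N_sub x by blast+
    then show False using no_4cycle[OF a(1) ba, of w] w b(2) by metis
  qed
  show 2: "a = a'" if a': "a' \<in> N x" "d a' = 2" "far x a = far x a'" for a'
    using 4[OF a'(1)] N_two(1)[OF x a'(1,2)] a'(3) by auto
  have p: "p \<in> X" "p \<in> N (far x a)" "p \<noteq> a" "far x a \<in> N p" if "p \<in> beyond x a" for p
    using that b(3) N_sub N_sym by (auto simp: beyond_def)
  show 3: "p \<noteq> x \<and> p \<notin> N x" if "p \<in> beyond x a" for p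
  proof
    show "p \<noteq> x" using p(2)[OF that] 1 N_sym[OF b(3), of p] by blast
    show "p \<notin> N x" using 4[of p] p[OF that] by blast
  qed
  show 5: "p \<noteq> far x a'" if "p \<in> beyond x a" "a' \<in> N x" "d a' = 2" for p a'
  proof
    assume eq: "p = far x a'"
    note b' = N_two[OF x that(2,3)] and pp = p[OF that(1)]
    have "a' \<noteq> a" using eq pp(2) N_irr by blast
    have xa': "x \<in> N a'" using b'(1) by auto
    have "a' \<in> N p" using b'(4) eq by simp
    moreover have "distinct [x, a, far x a, p, a']"
      using a(1) N_irr[of x] b b' pp 1 3[OF that(1)] \<open>a' \<noteq> a\<close> that(2) eq N_irr[of p] by auto
    ultimately show False using no_5cycle[of x a "far x a" p a'] a(1) ba pp(2) xa' by blast
  qed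
  show 6: "z \<noteq> x \<and> z \<notin> N x" if z: "p \<in> beyond x a" "z \<in> N p - {far x a}" for p z
  proof
    note pp = p[OF z(1)]
    show "z \<noteq> x" using 3[OF z(1)] N_sym[of p z] pp(1) z(2) by blast
    show "z \<notin> N x"
    proof
      assume zx: "z \<in> N x"
      have xz: "x \<in> N z" using N_sym[OF x zx] .
      have pz: "p \<in> N z" using N_sym[of p z] pp(1) z(2) by blast
      have "z \<noteq> a" using pz b(1) 3[OF z(1)] pp(2) N_irr[of "far x a"] by auto
      then have "distinct [x, a, far x a, p, z]"
        using a(1) N_irr[of x] b pp 1 3[OF z(1)] zx z(2) N_irr[of p] by auto
      then show False using no_5cycle[of x a "far x a" p z] a(1) ba pp(2) z(2) xz by blast
    qed
  qed
  show "z \<noteq> far x a'" if z: "p \<in> beyond x a" "z \<in> N p - {far x a}" and a': "a' \<in> N x" "d a' = 2" for p z a'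
  proof
    assume eq: "z = far x a'"
    note b' = N_two[OF x a'] and pp = p[OF z(1)]
    have "a' \<noteq> a" using eq z(2) by auto
    have xa': "x \<in> N a'" using b'(1) by auto
    have "a' \<in> N z" using b'(4) eq by simp
    moreover have "distinct [x, a, far x a, p, z, a']"
    proof -
      have "x \<noteq> a" "x \<noteq> a'" using a(1) a'(1) N_irr[of x] by metis+
      moreover have "x \<noteq> far x a" "a \<noteq> far x a" using b(2,5) by metis+
      moreover have "x \<noteq> p" "p \<noteq> a'" using 3[OF z(1)] a'(1) by metis+
      moreover have "x \<noteq> z" "a \<noteq> z" "z \<noteq> a'" using 6[OF z] a(1) a'(1) by metis+
      moreover have "far x a \<noteq> p" "p \<noteq> z" using pp(2) z(2) N_irr[of p] N_irr[of "far x a"] by blast+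
      moreover have "far x a \<noteq> a'" using 1 a'(1) by metis
      ultimately show ?thesis using pp(3) \<open>a' \<noteq> a\<close> z(2) by auto
    qed
    ultimately show False using no_6cycle[of x a "far x a" p z a'] a(1) ba pp(2) xa' z(2) by blast
  qed
qed

lemma card_soft_stiff: "card (soft x) + card (stiff x) = d x"
proof -
  have sub: "soft x \<subseteq> N x" using soft_N by blast
  then have "finite (soft x)" using finite_subset by blast
  then show ?thesis
    using sub card_mono[OF finN sub] unfolding stiff_def d_def by (simp add: card_Diff_subset)
qed

lemma card_beyond:
  assumes "x \<in> X" "a \<in> N x" "d a = 2"
  shows "card (beyond x a) = d (far x a) - 1"
  using N_two(4)[OF assms] by (simp add: beyond_def d_def)

lemma card_far_list:
  assumes "x \<in> X" "a \<in> N x" "d a = 2"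
  shows "k + 2 - (\<Sum>p\<in>beyond x a. d p) \<le> card (K - \<phi> ` near_via (beyond x a) (far x a))"
proof -
  have sub: "beyond x a \<subseteq> N (far x a)" by (auto simp: beyond_def)
  have "card (\<phi> ` near_via (beyond x a) (far x a)) \<le> (\<Sum>p\<in>beyond x a. d p)"
    using card_near_via[OF N_two(3)[OF assms] sub]
      card_image_le[OF finite_near_via[OF sub], of \<phi>] by (meson le_trans)
  then show ?thesis
    using diff_card_le_card_Diff[of "\<phi> ` near_via (beyond x a) (far x a)" K]
      finite_near_via[OF sub] cardK by simp
qed

text \<open>
  Delete the needy neighbours of \<open>x\<close>, colour the rest, give \<open>x\<close> the colour \<open>c\<close>,
  and recolour the needy neighbours together with their second vertices by
  \<open>choose_hub_colours\<close>. Other neighbours of \<open>x\<close> keep their colours, which are distinct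
  because \<open>x\<close> itself has not been deleted. If there are \<open>n\<close> needy neighbours, then
  \<open>k - n\<close> colours are used by the others and one by \<open>x\<close>, so at least \<open>n + 1\<close> colours
  are available. By \<open>hub_layers\<close> the second vertices can be recoloured independently.
\<close>
lemma hub_recolour:
  assumes x: "x \<in> X" "d x = k"
    and \<phi>: "proper_colouring adj K (X - soft x) \<phi>"
    and c: "c \<in> K" "c \<notin> \<phi> ` near_via (stiff x) x"
    and a1: "a1 \<in> soft x" "card (\<phi> ` beyond x a1 - {c}) \<le> 1"
      "2 \<le> card (K - \<phi> ` near_via (beyond x a1) (far x a1) - {c})"
    and two: "2 \<le> card (soft x)"
  shows False
proof -
  let ?A = "soft x" and ?W = "stiff x"
  define L where "L a = K - \<phi> ` near_via (beyond x a) (far x a)" for a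
  have AN: "?A \<subseteq> N x" using soft_N by blast
  have finA: "finite ?A" using AN finite_subset by blast
  have WN: "?W \<subseteq> N x" by (auto simp: stiff_def)
  have finW: "finite ?W" using WN finite_subset by blast
  have cNx: "card ?A + card ?W = k" using card_soft_stiff x(2) by simp
  have cardL: "k + 2 - (\<Sum>p\<in>beyond x a. d p) \<le> card (L a)" if "a \<in> ?A" for a
    using card_far_list[OF x(1)] soft_N[OF that] by (simp add: L_def)
  have cbey: "card (beyond x a) = d (far x a) - 1" if "a \<in> ?A" for a
    using card_beyond[OF x(1)] soft_N[OF that] by blast
  obtain a2 where a2: "a2 \<in> ?A" "a1 \<noteq> a2"
    using ex_diff[of "{a1}" ?A] two by auto
  define D where "D = K - insert c (\<phi> ` ?W)"
  have "card (insert c (\<phi> ` ?W)) \<le> Suc (card ?W)"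
    using card_image_le[OF finW, of \<phi>] finW by (simp add: card_insert_if)
  then have cardD: "Suc (card ?A) \<le> card D"
    using diff_card_le_card_Diff[of "insert c (\<phi> ` ?W)" K] finW cardK cNx by (simp add: D_def)
  have "\<exists>\<alpha> \<beta>. inj_on \<alpha> ?A \<and> (\<forall>a\<in>?A. \<alpha> a \<in> D \<and> \<beta> a \<in> L a \<and> \<beta> a \<noteq> c \<and> \<alpha> a \<noteq> \<beta> a
      \<and> \<alpha> a \<notin> \<phi> ` beyond x a)"
  proof (rule choose_hub_colours[OF finA a1(1) a2])
    show "finite D" "c \<notin> D" using finK by (auto simp: D_def)
    show "Suc (card ?A) \<le> card D" by (rule cardD)
    show "card (\<phi> ` beyond x a1 - {c}) \<le> 1" "2 \<le> card (L a1 - {c})" using a1 by (simp_all add: L_def)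
    fix a assume a: "a \<in> ?A"
    have fb: "finite (beyond x a)" by (simp add: beyond_def)
    then show "finite (\<phi> ` beyond x a)" by simp
    have cb: "card (\<phi> ` beyond x a) \<le> d (far x a) - 1"
      using card_image_le[OF fb, of \<phi>] cbey[OF a] by simp
    from a consider "a \<in> chains x" | "a \<in> twigs x" by (auto simp: soft_def)
    then show "card (\<phi> ` beyond x a) \<le> 1 \<and> L a - {c} \<noteq> {} \<or> card (\<phi> ` beyond x a) \<le> 2 \<and> 3 \<le> card (L a)"
    proof cases
      case 1
      then have "card (beyond x a) = 1" using cbey[OF a] by (simp add: chains_def)
      then obtain y where y: "beyond x a = {y}" by (rule card_1_singletonE)
      then have "d y \<le> k" using d_le N_sub by (auto simp: beyond_def)
      then have "2 \<le> card (L a)" using cardL[OF a] y by simp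
      then have "\<exists>l. l \<in> L a \<and> l \<notin> {c}" by (intro ex_diff) auto
      then show ?thesis using cb 1 by (auto simp: chains_def)
    next
      case 2
      then show ?thesis using cb cardL[OF a] k by (auto simp: twigs_def)
    qed
  qed
  then obtain \<alpha> \<beta> where \<alpha>: "inj_on \<alpha> ?A" and \<alpha>\<beta>: "\<And>a. a \<in> ?A \<Longrightarrow> \<alpha> a \<in> D \<and> \<beta> a \<in> L a \<and> \<beta> a \<noteq> c
      \<and> \<alpha> a \<noteq> \<beta> a \<and> \<alpha> a \<notin> \<phi> ` beyond x a" by blast
  let ?B = "far x ` ?A"
  have injB: "inj_on (far x) ?A"
    using hub_layers(2)[OF x(1)] soft_N by (intro inj_onI) blast
  define \<psi> where "\<psi> z = (if z = x then c else if z \<in> ?A then \<alpha> z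
      else if z \<in> ?B then \<beta> (inv_into ?A (far x) z) else \<phi> z)" for z
  have xA: "x \<notin> ?A" using AN N_irr by blast
  have BN: "b \<notin> N x" "b \<noteq> x" "b \<in> X" if "b \<in> ?B" for b
  proof -
    from that obtain a where a: "a \<in> ?A" "b = far x a" by blast
    then have s: "a \<in> N x" "d a = 2" using soft_N by blast+
    show "b \<notin> N x" "b \<noteq> x" "b \<in> X"
      using hub_layers(1)[OF x(1) s] N_two(2,3)[OF x(1) s] a(2) by simp_all
  qed
  have \<psi>x: "\<psi> x = c" by (simp add: \<psi>_def)
  have \<psi>A: "\<psi> a = \<alpha> a" if "a \<in> ?A" for a using that xA by (auto simp: \<psi>_def)
  have \<psi>B: "\<psi> (far x a) = \<beta> a" if "a \<in> ?A" for a
  proof -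
    have "far x a \<in> ?B" using that by blast
    then have "far x a \<noteq> x" "far x a \<notin> ?A" using BN AN by blast+
    then show ?thesis using that injB by (simp add: \<psi>_def)
  qed
  have \<psi>o: "\<psi> z = \<phi> z" if "z \<noteq> x" "z \<notin> ?A" "z \<notin> ?B" for z using that by (simp add: \<psi>_def)
  have \<psi>W: "\<psi> w = \<phi> w" if "w \<in> ?W" for w
    using that WN BN N_irr[of x] by (intro \<psi>o) (auto simp: stiff_def)
  have \<psi>P: "\<psi> p = \<phi> p" if a: "a \<in> ?A" and p: "p \<in> beyond x a" for a p
  proof -
    have s: "a \<in> N x" "d a = 2" using soft_N[OF a] by blast+
    have "p \<noteq> far x a'" if "a' \<in> ?A" for a'
      using hub_layers(4)[OF x(1) s p] soft_N[OF that] by blast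
    then have "p \<notin> ?B" by blast
    then show ?thesis using hub_layers(3)[OF x(1) s p] AN by (intro \<psi>o) auto
  qed
  have \<psi>P2: "\<psi> z = \<phi> z" if a: "a \<in> ?A" and p: "p \<in> beyond x a" "z \<in> N p - {far x a}" for a p z
  proof -
    have s: "a \<in> N x" "d a = 2" using soft_N[OF a] by blast+
    have "z \<noteq> far x a'" if "a' \<in> ?A" for a'
      using hub_layers(6)[OF x(1) s p] soft_N[OF that] by blast
    then have "z \<notin> ?B" by blast
    then show ?thesis using hub_layers(5)[OF x(1) s p] AN by (intro \<psi>o) auto
  qed
  have \<psi>W2: "\<psi> z = \<phi> z" if w: "w \<in> ?W" "z \<in> N w - {x}" for w z
  proof (rule \<psi>o)
    show "z \<noteq> x" using w by blast
    have wN: "w \<in> N x" "w \<notin> ?A" using w(1) by (auto simp: stiff_def)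
    show "z \<notin> ?A"
    proof
      assume "z \<in> ?A"
      then have "x \<in> N z" using N_sym[OF x(1)] AN by blast
      then show False using no_triangle[OF x(1) wN(1), of z] w by blast
    qed
    show "z \<notin> ?B"
    proof
      assume "z \<in> ?B"
      then obtain a where "a \<in> ?A" "z = far x a" by blast
      then show False using hub_layers(7)[OF x(1), of a w] soft_N wN w by blast
    qed
  qed
  let ?S = "insert x (?A \<union> ?B)"
  show False
  proof (rule recolour[OF \<phi>, of ?S \<psi>])
    show "\<psi> s \<in> K" if "s \<in> ?S" for s
      using that c \<alpha>\<beta> \<psi>x \<psi>A \<psi>B by (auto simp: D_def L_def)
    show "\<psi> z = \<phi> z" if "z \<in> X - ?S" for z using that by (intro \<psi>o) auto
    show "y = y'" if "a \<in> ?A" "y \<in> N a - ?S" "y' \<in> N a - ?S" for a y y'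
      using that N_two(1)[OF x(1), of a] soft_N[of a x] by auto
    have ab: "\<psi> x \<noteq> \<psi> a \<and> \<psi> x \<noteq> \<psi> (far x a) \<and> \<psi> a \<noteq> \<psi> (far x a)" if "a \<in> ?A" for a
      using \<alpha>\<beta>[OF that] \<psi>A[OF that] \<psi>B[OF that] \<psi>x by (auto simp: D_def)
    have xw: "\<psi> x \<noteq> \<psi> w" if "w \<in> ?W" for w
      using c(2) \<psi>W[OF that] \<psi>x that by (auto simp: near_via_def)
    have aw: "\<psi> a \<noteq> \<psi> w" if "a \<in> ?A" "w \<in> ?W" for a w
      using \<alpha>\<beta>[OF that(1)] \<psi>W[OF that(2)] \<psi>A[OF that(1)] that(2) by (auto simp: D_def)
    fix s z assume "s \<in> ?S" "s \<in> X" and z: "z \<in> near_via (N s) s"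
    then consider "s = x" | "s \<in> ?A" | a where "a \<in> ?A" "s = far x a" by blast
    then show "\<psi> s \<noteq> \<psi> z"
    proof cases
      case 1
      from z 1 obtain u where u: "u \<in> N x" "z = u \<or> z \<in> N u - {x}" by (auto simp: near_via_def)
      show ?thesis
      proof (cases "u \<in> ?A")
        case True
        then have "z = u \<or> z = far x u" using u N_two(1)[OF x(1), of u] soft_N[of u x] by auto
        then show ?thesis using ab[OF True] 1 by blast
      next
        case False
        then have uW: "u \<in> ?W" using u by (simp add: stiff_def)
        from u(2) show ?thesis
        proof
          assume "z = u"
          then show ?thesis using xw[OF uW] 1 by simp
        next
          assume zu: "z \<in> N u - {x}"
          then have "z \<in> near_via ?W x" using uW by (auto simp: near_via_def)
          then show ?thesis using c(2) \<psi>W2[OF uW zu] \<psi>x 1 by auto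
        qed
      qed
    next
      case 2
      then have Ns: "N s = {x, far x s}" using N_two(1)[OF x(1), of s] soft_N by blast
      then consider "z = x" | "z = far x s" | "z \<in> N x" "z \<noteq> s" | "z \<in> beyond x s"
        using z by (auto simp: near_via_def beyond_def)
      then show ?thesis
      proof cases
        case 3
        show ?thesis
        proof (cases "z \<in> ?A")
          case True
          then show ?thesis using inj_onD[OF \<alpha>, of s z] 2 3 \<psi>A by auto
        next
          case False
          then show ?thesis using aw[OF 2, of z] 3 by (simp add: stiff_def)
        qed
      next
        case 4
        then show ?thesis using \<psi>P[OF 2 4] \<alpha>\<beta>[OF 2] \<psi>A[OF 2] by auto
      qed (use ab[OF 2] in auto)
    next
      case 3
      note a = 3(1)
      have Na: "N a = {x, far x a}" using N_two(1)[OF x(1), of a] soft_N a by blast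
      have "N s = insert a (beyond x a)"
        using N_two(4)[OF x(1), of a] soft_N[OF a] 3(2) by (auto simp: beyond_def)
      then consider "z = a" | "z = x" | "z \<in> near_via (beyond x a) s"
        using z Na 3(2) by (auto simp: near_via_def)
      then show ?thesis
      proof cases
        case 1
        then show ?thesis using ab[OF a] 3(2) by auto
      next
        case 2
        then show ?thesis using ab[OF a] 3(2) by auto
      next
        case z: 3
        have "\<psi> z = \<phi> z"
          using z \<psi>P[OF a] \<psi>P2[OF a] 3(2) unfolding near_via_def by blast
        moreover have "\<beta> a \<notin> \<phi> ` near_via (beyond x a) s" using \<alpha>\<beta>[OF a] 3(2) by (simp add: L_def)
        ultimately show ?thesis using \<psi>B[OF a] 3(2) z by (metis image_eqI)
      qed
    qed
  qed auto
qed


text \<open>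
  If the other neighbours of \<open>x\<close> had a smaller degree sum, three colours would be available
  for \<open>x\<close>. The second vertex of a chain has a list of at least two colours, and one of the
  three leaves it two colours to choose from.
\<close>
lemma chain_hub:
  assumes x: "x \<in> X" "d x = k" and "chains x \<noteq> {}"
  shows "k \<le> (\<Sum>w\<in>stiff x. d w)"
proof (rule ccontr)
  assume "\<not> ?thesis"
  then have light: "(\<Sum>w\<in>stiff x. d w) \<le> k - 1" by simp
  obtain a1 where a1: "a1 \<in> chains x" using assms(3) by blast
  then have s: "a1 \<in> soft x" "a1 \<in> N x" "d a1 = 2" by (auto simp: soft_def chains_def)
  then have "X - soft x \<subset> X" using N_sub by blast
  then obtain \<phi> where \<phi>: "proper_colouring adj K (X - soft x) \<phi>" using minimal by blast
  have WN: "stiff x \<subseteq> N x" by (auto simp: stiff_def)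
  let ?F = "\<phi> ` near_via (stiff x) x" and ?L = "K - \<phi> ` near_via (beyond x a1) (far x a1)"
  have finF: "finite ?F" using finite_near_via[OF WN] by simp
  have "card ?F \<le> k - 1"
    using card_near_via[OF x(1) WN] card_image_le[OF finite_near_via[OF WN], of \<phi>] light by linarith
  then have KF: "3 \<le> card (K - ?F)"
    using diff_card_le_card_Diff[OF finF, of K] cardK k by linarith
  have cb: "card (beyond x a1) = 1" using card_beyond[OF x(1) s(2,3)] a1 by (simp add: chains_def)
  then obtain y where y: "beyond x a1 = {y}" by (rule card_1_singletonE)
  then have "d y \<le> k" using d_le N_sub by (auto simp: beyond_def)
  then have L2: "2 \<le> card ?L" using card_far_list[OF x(1) s(2,3), of \<phi>] y by simp
  have finL: "finite ?L" using finK by simp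
  \<comment> \<open>A list of three colours can spare any of them; a list of two misses one of the three candidates.\<close>
  have "\<exists>c. c \<in> K - ?F \<and> 2 \<le> card (?L - {c})"
  proof (cases "3 \<le> card ?L")
    case True
    obtain c where "c \<in> K - ?F" using KF by (metis card.empty ex_in_conv not_numeral_le_zero)
    moreover have "2 \<le> card (?L - {c})"
      using True diff_card_le_card_Diff[of "{c}" ?L] by simp
    ultimately show ?thesis by blast
  next
    case False
    then obtain c where "c \<in> K - ?F" "c \<notin> ?L" using ex_diff[OF finL, of "K - ?F"] KF by auto
    then have "?L - {c} = ?L" by blast
    then show ?thesis using \<open>c \<in> K - ?F\<close> L2 by metis
  qed
  then obtain c where c: "c \<in> K" "c \<notin> ?F" "2 \<le> card (?L - {c})" by blast
  have "2 \<le> d w" if "w \<in> stiff x" for w using that WN N_sub min_degree by blast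
  then have "2 * card (stiff x) \<le> (\<Sum>w\<in>stiff x. d w)"
    using sum_mono[of "stiff x" "\<lambda>_. 2" d] by (simp add: mult.commute)
  then have "2 \<le> card (soft x)" using light card_soft_stiff[of x] x(2) k by linarith
  moreover have "card (\<phi> ` beyond x a1 - {c}) \<le> 1"
    using y card_mono[of "{\<phi> y}" "\<phi> ` beyond x a1 - {c}"] by auto
  ultimately show False using hub_recolour[OF x \<phi> c(1,2) s(1) _ c(3)] by blast
qed

text \<open>
  Suppose that all neighbours of \<open>x\<close> are needy. Nothing else restricts the colour of
  \<open>x\<close>, so it can be the colour of one of the two vertices beyond the first twig. Then that
  twig has only one more colour to avoid.
\<close>
lemma stiff_nonempty:
  assumes x: "x \<in> X" "d x = k"
  shows "stiff x \<noteq> {}"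
proof
  assume W: "stiff x = {}"
  then have noch: "chains x = {}" using chain_hub[OF x] k by auto
  have soft: "soft x = N x" using W soft_N by (auto simp: stiff_def)
  then have cs: "card (soft x) = k" using x(2) by (simp add: d_def)
  then have "soft x \<noteq> {}" using k by auto
  then obtain a1 where a1: "a1 \<in> soft x" by blast
  then have tw: "a1 \<in> twigs x" using noch by (simp add: soft_def)
  have s: "a1 \<in> N x" "d a1 = 2" using soft_N[OF a1] by auto
  have "X - soft x \<subset> X" using a1 s N_sub by blast
  then obtain \<phi> where \<phi>: "proper_colouring adj K (X - soft x) \<phi>" using minimal by blast
  have cb: "card (beyond x a1) = 2" using card_beyond[OF x(1) s] tw by (simp add: twigs_def)
  then obtain p where p: "p \<in> beyond x a1" by (metis card.empty ex_in_conv zero_neq_numeral)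
  then have "p \<in> X - soft x"
    using hub_layers(3)[OF x(1) s p] soft N_sub by (auto simp: beyond_def)
  then have pK: "\<phi> p \<in> K" using \<phi> by (auto simp: proper_colouring_def)
  have fb: "finite (beyond x a1)" by (simp add: beyond_def)
  have "card (\<phi> ` beyond x a1 - {\<phi> p}) = card (\<phi> ` beyond x a1) - 1"
    using p fb by (intro card_Diff_singleton) auto
  then have Q: "card (\<phi> ` beyond x a1 - {\<phi> p}) \<le> 1"
    using card_image_le[OF fb, of \<phi>] cb by simp
  let ?L = "K - \<phi> ` near_via (beyond x a1) (far x a1)"
  have "(\<Sum>p\<in>beyond x a1. d p) \<le> 5" using tw by (simp add: twigs_def)
  then have "3 \<le> card ?L" using card_far_list[OF x(1) s, of \<phi>] k by linarith
  then have "2 \<le> card (?L - {\<phi> p})" using diff_card_le_card_Diff[of "{\<phi> p}" ?L] by simp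
  moreover have "\<phi> p \<notin> \<phi> ` near_via (stiff x) x" using W by (simp add: near_via_def)
  ultimately show False using hub_recolour[OF x \<phi> pK _ a1 Q] cs k by simp
qed

section \<open>Discharging\<close>

text \<open>
  What a vertex of degree at least 4 can give to each neighbour of degree at most 3 out of its
  charge \<open>5 d - 14\<close>. In degree 4 the charge 6 is divided by 3 instead of 4 if one neighbour
  has degree at least 4 and so receives nothing.
\<close>
definition gift :: "'a \<Rightarrow> real" where
  "gift u = (if 8 \<le> d u then 3 else if 6 \<le> d u then 5/2 else if d u = 5 then 2
     else if d u = 4 then (if \<exists>w\<in>N u. 4 \<le> d w then 2 else 3/2) else 0)"

text \<open>
  A chain gets its whole lack of 4 from the vertex of degree \<open>k\<close>, since its second vertex has
  nothing to give. A twig gets \<open>11/3\<close>, and the second vertex adds the missing \<open>1/3\<close>.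
\<close>
definition bonus :: "'a \<Rightarrow> 'a \<Rightarrow> real" where
  "bonus u v = (if d u = k then (if v \<in> chains u then 1 else if v \<in> twigs u then 2/3 else 0) else 0)"

definition pool :: "'a \<Rightarrow> real" where
  "pool u = 1 + (\<Sum>w\<in>N u. gift w)"

definition twos :: "'a \<Rightarrow> real" where
  "twos u = (\<Sum>w\<in>N u. if d w = 2 then 1 else 0)"

text \<open>
  A vertex of degree 3 divides its charge 1 and everything it receives equally among its
  neighbours of degree 2.
\<close>
definition send :: "'a \<Rightarrow> 'a \<Rightarrow> real" where
  "send u v = (if d u = 3 then (if d v = 2 then pool u / twos u else 0)
     else if d v \<le> 3 then gift u + bonus u v else 0)"

lemma gift_nonneg: "0 \<le> gift u" by (simp add: gift_def)
lemma bonus_nonneg: "0 \<le> bonus u v" by (simp add: bonus_def)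
lemma gift_small: "d u \<le> 3 \<Longrightarrow> gift u = 0" by (simp add: gift_def)
lemma gift_ge4: "4 \<le> d u \<Longrightarrow> 3/2 \<le> gift u" by (simp add: gift_def)
lemma gift_ge5: "5 \<le> d u \<Longrightarrow> 2 \<le> gift u" by (simp add: gift_def)
lemma gift_ge6: "6 \<le> d u \<Longrightarrow> 5/2 \<le> gift u" by (simp add: gift_def)
lemma gift_ge8: "8 \<le> d u \<Longrightarrow> gift u = 3" by (simp add: gift_def)

lemma pool_pos: "1 \<le> pool u" by (simp add: pool_def gift_nonneg sum_nonneg)
lemma twos_nonneg: "0 \<le> twos u" by (simp add: twos_def sum_nonneg)

lemma send_nonneg: "0 \<le> send u v"
  using pool_pos[of u] twos_nonneg[of u] gift_nonneg[of u] bonus_nonneg[of u v] by (simp add: send_def)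

lemma three_neighbours:
  assumes "b \<in> X" "d b = 3" "v \<in> N b"
  obtains p q where "N b = {v, p, q}" "v \<noteq> p" "v \<noteq> q" "p \<noteq> q" "2 \<le> d p" "2 \<le> d q"
    "(\<Sum>p\<in>N b - {v}. d p) = d p + d q"
proof -
  have "card (N b - {v}) = 2" using assms(2,3) by (simp add: d_def)
  then obtain p q where pq: "N b - {v} = {p, q}" "p \<noteq> q" by (meson card_2_iff)
  then have eq: "N b = {v, p, q}" and ne: "v \<noteq> p" "v \<noteq> q" using assms(3) by blast+
  have "p \<in> X" "q \<in> X" using eq N_sub by blast+
  then show ?thesis using that[OF eq ne pq(2)] min_degree pq by simp
qed

text \<open>
  The three bounds correspond to how rich the other two neighbours are. With degree sum at least 6
  there are at most two neighbours of degree 2, and if there are two then the third neighbour sends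
  at least \<open>3/2\<close>. With degree sum at least 10 the third neighbour has degree at least 8 and
  sends 3 in that case, and if \<open>v\<close> is the only neighbour of degree 2 then another one has
  degree at least 5 and sends at least 2.
\<close>
lemma send_from_three:
  assumes b: "b \<in> X" "d b = 3" and v: "v \<in> N b" "d v = 2"
  shows "1/3 \<le> send b v"
    and "6 \<le> (\<Sum>p\<in>N b - {v}. d p) \<Longrightarrow> 1 \<le> send b v"
    and "10 \<le> (\<Sum>p\<in>N b - {v}. d p) \<Longrightarrow> 2 \<le> send b v"
proof -
  obtain p q where pq: "N b = {v, p, q}" "v \<noteq> p" "v \<noteq> q" "p \<noteq> q" "2 \<le> d p" "2 \<le> d q"
    and sum: "(\<Sum>p\<in>N b - {v}. d p) = d p + d q"
    using three_neighbours[OF b v(1)] by metis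
  have pool: "pool b = 1 + gift p + gift q"
    using pq v(2) by (simp add: pool_def gift_small)
  have twos: "twos b = 1 + (if d p = 2 then 1 else 0) + (if d q = 2 then 1 else 0)"
    using pq v(2) by (simp add: twos_def)
  have send: "send b v = (1 + gift p + gift q) / (1 + (if d p = 2 then 1 else 0) + (if d q = 2 then 1 else 0))"
    using b v pool twos by (simp add: send_def)
  note nn = gift_nonneg[of p] gift_nonneg[of q]
  show "1/3 \<le> send b v" using nn unfolding send by (auto simp: field_simps)
  show "1 \<le> send b v" if six: "6 \<le> (\<Sum>p\<in>N b - {v}. d p)"
  proof -
    consider "d p = 2" "4 \<le> d q" | "d q = 2" "4 \<le> d p" | "d p \<noteq> 2" "d q \<noteq> 2"
      using six sum by linarith
    then show ?thesis using nn gift_ge4[of p] gift_ge4[of q] unfolding send by cases (auto simp: field_simps)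
  qed
  show "2 \<le> send b v" if ten: "10 \<le> (\<Sum>p\<in>N b - {v}. d p)"
  proof -
    consider "d p = 2" "8 \<le> d q" | "d q = 2" "8 \<le> d p" | "d p \<noteq> 2" "d q \<noteq> 2" "5 \<le> d p"
      | "d p \<noteq> 2" "d q \<noteq> 2" "5 \<le> d q"
      using ten sum pq(5,6) by linarith
    then show ?thesis
      using nn gift_ge5[of p] gift_ge5[of q] gift_ge8[of p] gift_ge8[of q] unfolding send
      by cases (auto simp: field_simps)
  qed
qed

text \<open>
  By \<open>two_vertex_weight\<close> the other three neighbours of \<open>b\<close> have degree sum at least 10,
  so one of them has degree at least 4.
\<close>
lemma gift_four:
  assumes v: "v \<in> X" "N v = {b, y}" "b \<noteq> y" and b: "d b = 4" and y: "d y \<le> 8"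
  shows "gift b = 2"
proof -
  have light: "k \<le> (\<Sum>p\<in>N b - {v}. d p)" using two_vertex_weight[OF v] b y k by simp
  have vb: "v \<in> N b" using N_sym[OF v(1), of b] v(2) by simp
  have "\<exists>w\<in>N b. 4 \<le> d w"
  proof (rule ccontr)
    assume "\<not> ?thesis"
    then have "d p \<le> 3" if "p \<in> N b - {v}" for p using that by fastforce
    then have "(\<Sum>p\<in>N b - {v}. d p) \<le> card (N b - {v}) * 3"
      using sum_bounded_above[of "N b - {v}" d 3] by simp
    also have "\<dots> = 9" using vb b by (simp add: d_def)
    finally show False using light k by simp
  qed
  then show ?thesis using b by (simp add: gift_def)
qed

text \<open>
  If \<open>y\<close> has degree \<open>k\<close> it gives at least 3, and the bonus makes up for a poor
  \<open>b\<close>. If both neighbours have a smaller degree and one of them has degree 3 or 4, then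
  \<open>two_vertex_weight\<close> provides it with rich neighbours of its own, so that it can give 2,
  or else the other one gives enough.
\<close>
lemma two_vertex_receives_ordered:
  assumes v: "v \<in> X" "N v = {b, y}" "b \<noteq> y" and le: "d b \<le> d y"
  shows "4 \<le> send b v + send y v"
proof -
  have dv: "d v = 2" using v by (simp add: d_def)
  have X: "b \<in> X" "y \<in> X" using v(2) N_sub by blast+
  have vN: "v \<in> N b" "v \<in> N y" using N_sym[OF v(1)] v(2) by auto
  have v': "N v = {y, b}" "y \<noteq> b" using v by auto
  have far: "far y v = b"
    using N_two(1,2)[OF X(2) vN(2) dv] v by (auto simp: doubleton_eq_iff)
  have d2: "2 \<le> d b" using min_degree X by blast
  have big: "gift u \<le> send u v" if "4 \<le> d u" for u
    using that dv bonus_nonneg[of u v] by (simp add: send_def)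
  have weight: "k \<le> (\<Sum>p\<in>N b - {v}. d p)" if "d b + d y \<le> k + 2"
    using two_vertex_weight[OF v that] .
  consider "d b = 2" | "d b = 3" "d y = k" | "4 \<le> d b" "d y = k" | "d b = 3" "d y < k"
    | "d b = 4" "d y < k" | "5 \<le> d b"
    using d2 d_le[OF X(2)] by linarith
  then show ?thesis
  proof cases
    case 1
    obtain z where z: "N b = {v, z}" "v \<noteq> z"
      using N_two(1,2)[OF v(1) _ 1] v(2) by (metis insertI1)
    \<comment> \<open>Here \<open>v\<close> and \<open>b\<close> exchange roles: \<open>y\<close> is the only further neighbour of \<open>v\<close>.\<close>
    have "d z \<le> k" using z N_sub d_le by blast
    then have "k \<le> (\<Sum>p\<in>N v - {b}. d p)" using two_vertex_weight[OF X(1) z] dv by simp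
    also have "N v - {b} = {y}" using v by auto
    finally have yk: "d y = k" using d_le[OF X(2)] by simp
    then have "v \<in> chains y" using 1 far vN dv by (simp add: chains_def)
    then have "send y v = 4" using yk dv k by (simp add: send_def bonus_def gift_ge8)
    then show ?thesis using send_nonneg[of b v] by simp
  next
    case 2
    have bey: "beyond y v = N b - {v}" by (simp add: beyond_def far)
    have gy: "gift y = 3" using 2 k by (simp add: gift_ge8)
    show ?thesis
    proof (cases "(\<Sum>p\<in>N b - {v}. d p) \<le> 5")
      case True
      then have "v \<in> twigs y" "v \<notin> chains y"
        using 2 far bey vN dv by (simp_all add: twigs_def chains_def)
      then have "send y v = 3 + 2/3" using 2 dv k gy by (simp add: send_def bonus_def)
      then show ?thesis using send_from_three(1)[OF X(1) 2(1) vN(1) dv] by simp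
    next
      case False
      then show ?thesis
        using send_from_three(2)[OF X(1) 2(1) vN(1) dv] big[of y] gy 2 k by simp
    qed
  next
    case 3
    then show ?thesis using big[of b] big[of y] gift_ge4[of b] gift_ge8[of y] k by simp
  next
    case 4
    have b2: "2 \<le> send b v"
      using send_from_three(3)[OF X(1) 4(1) vN(1) dv] weight 4 k by simp
    consider "d y = 3" | "d y = 4" | "5 \<le> d y" using le 4 by linarith
    then have "2 \<le> send y v"
    proof cases
      case 1
      then have "k \<le> (\<Sum>p\<in>N y - {v}. d p)" using two_vertex_weight[OF v(1) v'] 4 k by simp
      then show ?thesis using send_from_three(3)[OF X(2) 1 vN(2) dv] k by simp
    next
      case 2
      then show ?thesis using gift_four[OF v(1) v' 2] 4 big[of y] by simp
    next
      case 3
      then show ?thesis using gift_ge5[of y] big[of y] by simp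
    qed
    with b2 show ?thesis by simp
  next
    case 5
    consider "d y = 4" | "d y = 5" | "6 \<le> d y" using le 5 by linarith
    then show ?thesis
    proof cases
      case 1
      then show ?thesis using gift_four[OF v 5(1)] gift_four[OF v(1) v' 1] big[of b] big[of y] 5 by simp
    next
      case 2
      then show ?thesis using gift_four[OF v 5(1)] gift_ge5[of y] big[of b] big[of y] 5 by simp
    next
      case 3
      then show ?thesis using gift_ge4[of b] gift_ge6[of y] big[of b] big[of y] 5 by simp
    qed
  next
    case 6
    then show ?thesis using gift_ge5[of b] gift_ge5[of y] big[of b] big[of y] le by simp
  qed
qed

lemma two_vertex_receives:
  assumes "v \<in> X" "d v = 2"
  shows "4 \<le> (\<Sum>u\<in>N v. send u v)"
proof -
  obtain b y where ends: "N v = {b, y}" "b \<noteq> y" using assms(2) by (auto simp: d_def card_2_iff)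
  have ends': "N v = {y, b}" "y \<noteq> b" using ends by auto
  have "4 \<le> send b v + send y v"
  proof (cases "d b \<le> d y")
    case True
    then show ?thesis using two_vertex_receives_ordered[OF assms(1) ends] by blast
  next
    case False
    then show ?thesis using two_vertex_receives_ordered[OF assms(1) ends'] by simp
  qed
  then show ?thesis using ends by simp
qed

text \<open>
  If all neighbours of \<open>x\<close> were chains it would have to send \<open>4 k\<close>, which exceeds
  \<open>5 k - 14\<close> by at most 4 as \<open>k \<ge> 10\<close>. By \<open>chain_hub\<close>, the neighbours that are not
  needy save that amount: one of degree at least 4 costs nothing and saves 4, and otherwise there
  are at least four of them, each of which saves 1. Without chains one neighbour that is not needy
  suffices, since twigs cost only \<open>11/3\<close>.
\<close>
lemma hub_sends:
  assumes x: "x \<in> X" "d x = k"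
  shows "(\<Sum>v\<in>N x. send x v) \<le> 5 * real k - 14"
proof -
  define h :: "'a \<Rightarrow> real" where "h w = (if d w \<le> 3 then 3 else 0)" for w
  have WN: "stiff x \<subseteq> N x" by (auto simp: stiff_def)
  have finW: "finite (stiff x)" using WN finite_subset by blast
  have finS: "finite (soft x)" using soft_N finite_subset[of "soft x" "N x"] by blast
  have Nx: "N x = soft x \<union> stiff x" "soft x \<inter> stiff x = {}" using soft_N by (auto simp: stiff_def)
  have split: "(\<Sum>v\<in>N x. send x v) = (\<Sum>v\<in>soft x. send x v) + (\<Sum>v\<in>stiff x. send x v)"
    unfolding Nx(1) using finS finW Nx(2) by (rule sum.union_disjoint)
  have g3: "gift x = 3" "d x \<noteq> 3" using x k by (simp_all add: gift_ge8)
  have W: "(\<Sum>v\<in>stiff x. send x v) = (\<Sum>v\<in>stiff x. h v)"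
    using g3 by (intro sum.cong) (auto simp: send_def bonus_def h_def stiff_def soft_def)
  have card: "real (card (soft x)) + real (card (stiff x)) = real k"
    using card_soft_stiff[of x] x(2) by (metis of_nat_add)
  have ne: "stiff x \<noteq> {}" using stiff_nonempty[OF x] .
  then have m: "1 \<le> real (card (stiff x))" using finW by (simp add: Suc_le_eq card_gt_0_iff)
  have kr: "10 \<le> real k" using k by simp
  show ?thesis
  proof (cases "chains x = {}")
    case True
    have "(\<Sum>v\<in>soft x. send x v) \<le> real (card (soft x)) * (11/3)"
      using g3 x True by (intro sum_bounded_above) (auto simp: send_def bonus_def soft_def twigs_def)
    moreover have "(\<Sum>v\<in>stiff x. h v) \<le> real (card (stiff x)) * 3"
      by (intro sum_bounded_above) (simp add: h_def)
    ultimately show ?thesis using split W card m kr by (simp add: field_simps)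
  next
    case False
    have heavy: "k \<le> (\<Sum>w\<in>stiff x. d w)" using chain_hub[OF x False] .
    have S: "(\<Sum>v\<in>soft x. send x v) \<le> real (card (soft x)) * 4"
      using g3 x by (intro sum_bounded_above) (auto simp: send_def bonus_def soft_N)
    have slack: "4 \<le> (\<Sum>w\<in>stiff x. 4 - h w)"
    proof (cases "\<exists>w\<in>stiff x. 4 \<le> d w")
      case True
      then obtain w where w: "w \<in> stiff x" "4 \<le> d w" by blast
      have "4 - h w \<le> (\<Sum>w\<in>stiff x. 4 - h w)"
        using w(1) finW by (intro member_le_sum) (auto simp: h_def)
      then show ?thesis using w(2) by (simp add: h_def)
    next
      case no: False
      then have le3: "d w \<le> 3" if "w \<in> stiff x" for w using that by fastforce
      then have "(\<Sum>w\<in>stiff x. d w) \<le> card (stiff x) * 3"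
        using sum_bounded_above[of "stiff x" d 3] by simp
      then have "4 \<le> card (stiff x)" using heavy k by linarith
      moreover have "(\<Sum>w\<in>stiff x. 4 - h w) = (\<Sum>w\<in>stiff x. 1)"
        using le3 by (intro sum.cong) (auto simp: h_def)
      ultimately show ?thesis by simp
    qed
    have "(\<Sum>w\<in>stiff x. 4 - h w) = real (card (stiff x)) * 4 - (\<Sum>w\<in>stiff x. h w)"
      by (simp add: sum_subtractf)
    then show ?thesis using split W S card slack kr by linarith
  qed
qed

lemma mid_sends:
  assumes v: "v \<in> X" "4 \<le> d v" "d v \<noteq> k"
  shows "(\<Sum>u\<in>N v. send v u) \<le> 5 * real (d v) - 14"
proof -
  have eq: "send v u = (if d u \<le> 3 then gift v else 0)" for u
    using v by (simp add: send_def bonus_def)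
  have send_le: "send v u \<le> gift v" for u using gift_nonneg[of v] by (simp add: eq)
  then have le: "(\<Sum>u\<in>N v. send v u) \<le> real (d v) * gift v"
    unfolding d_def by (intro sum_bounded_above)
  consider "8 \<le> d v" | "6 \<le> d v" "d v < 8" | "d v = 5" | "d v = 4" "\<not> (\<exists>w\<in>N v. 4 \<le> d w)"
    | w where "d v = 4" "w \<in> N v" "4 \<le> d w"
    using v(2) by fastforce
  then show ?thesis
  proof cases
    case (5 w)
    have "(\<Sum>u\<in>N v. send v u) = (\<Sum>u\<in>N v - {w}. send v u)"
      using 5 by (subst sum.remove[OF finN, of w]) (simp_all add: eq)
    also have "\<dots> \<le> real (card (N v - {w})) * gift v"
      using send_le by (intro sum_bounded_above)
    also have "card (N v - {w}) = 3" using 5 by (simp add: d_def)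
    also have "gift v = 2" using 5 by (auto simp: gift_def)
    finally show ?thesis using 5 by simp
  qed (use le in \<open>auto simp: gift_def\<close>)
qed

definition final :: "'a \<Rightarrow> real" where
  "final v = 5 * real (d v) - 14 + (\<Sum>u\<in>N v. send u v) - (\<Sum>u\<in>N v. send v u)"

lemma final_nonneg:
  assumes v: "v \<in> X"
  shows "0 \<le> final v"
proof -
  have inn: "0 \<le> (\<Sum>u\<in>N v. send u v)" by (simp add: send_nonneg sum_nonneg)
  consider "d v = 2" | "d v = 3" | "4 \<le> d v" "d v \<noteq> k" | "d v = k"
    using min_degree[OF v] by linarith
  then show ?thesis
  proof cases
    case 1
    then have "send v u = 0" for u using k by (simp add: send_def gift_small bonus_def)
    then show ?thesis using two_vertex_receives[OF v 1] 1 by (simp add: final_def)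
  next
    case 2
    have "send u v = gift u" for u
      using 2 by (simp add: send_def bonus_def chains_def twigs_def gift_small)
    then have "1 + (\<Sum>u\<in>N v. send u v) = pool v" by (simp add: pool_def)
    moreover have "(\<Sum>u\<in>N v. send v u) \<le> pool v"
    proof -
      have "send v u = pool v / twos v * (if d u = 2 then 1 else 0)" for u using 2 by (simp add: send_def)
      then have "(\<Sum>u\<in>N v. send v u) = pool v / twos v * twos v"
        by (simp add: twos_def sum_distrib_left)
      then show ?thesis using pool_pos[of v] by (cases "twos v = 0") auto
    qed
    ultimately show ?thesis using 2 by (simp add: final_def)
  next
    case 3
    then show ?thesis using mid_sends[OF v 3] inn by (simp add: final_def)
  next
    case 4
    then show ?thesis using hub_sends[OF v 4] inn by (simp add: final_def)
  qed
qed

theorem critical_degree_sum: "14 * card X \<le> 5 * (\<Sum>v\<in>X. d v)"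
proof -
  have N: "N v = {u \<in> X. adj v u}" "N v = {u \<in> X. adj u v}" for v using sym by (auto simp: N_def)
  have "(\<Sum>v\<in>X. \<Sum>u\<in>N v. send u v) = (\<Sum>v\<in>X. \<Sum>u | u \<in> X \<and> adj v u. send u v)"
    by (simp add: N_def)
  also have "\<dots> = (\<Sum>u\<in>X. \<Sum>v | v \<in> X \<and> adj v u. send u v)"
    by (rule sum.swap_restrict[OF finX finX])
  also have "\<dots> = (\<Sum>u\<in>X. \<Sum>v\<in>N u. send u v)" by (simp add: N(2))
  finally have "(\<Sum>v\<in>X. final v) = (\<Sum>v\<in>X. 5 * real (d v) - 14)"
    by (simp add: final_def sum.distrib sum_subtractf)
  moreover have "0 \<le> (\<Sum>v\<in>X. final v)" by (intro sum_nonneg final_nonneg)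
  ultimately have "0 \<le> 5 * (\<Sum>v\<in>X. real (d v)) - 14 * real (card X)"
    by (simp add: sum_subtractf sum_distrib_left mult.commute)
  then have "real (14 * card X) \<le> real (5 * (\<Sum>v\<in>X. d v))" by simp
  then show ?thesis by (simp only: of_nat_le_iff)
qed

end

section \<open>Girth, degree and distance in digraphs\<close>

lemma (in graph) adj_props:
  shows "(u, v) \<in> arcs_ends G \<Longrightarrow> (v, u) \<in> arcs_ends G"
    and "(v, v) \<notin> arcs_ends G"
  using arcs_ends_symmetric[OF sym_arcs] adj_not_same by blast+

lemma (in graph) out_degree_neighbours: "out_degree G v = card {u \<in> verts G. (v, u) \<in> arcs_ends G}"
proof -
  have "{u \<in> verts G. (v, u) \<in> arcs_ends G} = head G ` out_arcs G v"
    by (auto simp: arcs_ends_conv image_iff)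
  moreover have "inj_on (head G) (out_arcs G v)"
    using no_multi_arcs by (auto simp: inj_on_def arc_to_ends_def)
  ultimately show ?thesis by (simp add: out_degree_def card_image)
qed

lemma (in graph) degree_le_max_degree:
  assumes "v \<in> verts G" shows "card {u \<in> verts G. (v, u) \<in> arcs_ends G} \<le> max_degree G"
  unfolding out_degree_neighbours[symmetric] max_degree_def using assms by (intro Max_ge) auto

text \<open>
  The distance is an infimum over walks, but a walk of length at most 2 must exist, as otherwise
  the infimum would be at least 3.
\<close>
lemma (in graph) distance_two:
  assumes "graph_distance G x y \<le> 2" "x \<noteq> y"
  shows "(x, y) \<in> arcs_ends G \<or> (\<exists>z\<in>verts G. (x, z) \<in> arcs_ends G \<and> (z, y) \<in> arcs_ends G)"
proof (rule ccontr)
  assume far: "\<not> ?thesis"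
  have adj: "(tail G a, head G a) \<in> arcs_ends G" if "a \<in> arcs G" for a
    using that by (auto simp: arcs_ends_conv)
  have long: "3 \<le> length p" if p: "awalk x p y" for p
  proof (rule ccontr)
    assume short: "\<not> 3 \<le> length p"
    have arcs: "set p \<subseteq> arcs G" and walk: "cas x p y" using p by (auto simp: awalk_def)
    consider "p = []" | a where "p = [a]" | a b where "p = [a, b]"
      using short by (cases p; cases "tl p"; cases "tl (tl p)") auto
    then show False
    proof cases
      case 1
      then show ?thesis using walk assms(2) by simp
    next
      case (2 a)
      then show ?thesis using walk arcs adj[of a] far by auto
    next
      case (3 a b)
      then show ?thesis using walk arcs adj[of a] adj[of b] far by auto
    qed
  qed
  have cost: "awalk_cost (\<lambda>_. 1) p = real (length p)" for p by (induction p) auto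
  have "3 \<le> graph_distance G x y"
    unfolding graph_distance_def \<mu>_def
  proof (rule INF_greatest)
    fix p assume "p \<in> {p. awalk x p y}"
    then have "3 \<le> real (length p)" using long by fastforce
    then show "3 \<le> ereal (awalk_cost (\<lambda>_. 1) p)" unfolding cost by simp
  qed
  then have "(3::ereal) \<le> 2" using assms(1) by (rule order_trans)
  then show False by simp
qed

lemma (in graph) walk_through:
  assumes "vs \<noteq> []" "set vs \<subseteq> verts G" "successively (\<lambda>x y. (x, y) \<in> arcs_ends G) vs"
  shows "\<exists>p. awalk (hd vs) p (last vs) \<and> awalk_verts (hd vs) p = vs"
  using assms
proof (induction vs rule: induct_list012)
  case (2 v)
  then show ?case by (intro exI[of _ "[]"]) (simp add: awalk_Nil_iff)
next
  case (3 v w vs)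
  then obtain p where p: "awalk w p (last (w # vs))" "awalk_verts w p = w # vs" by auto
  obtain a where a: "a \<in> arcs G" "tail G a = v" "head G a = w"
    using 3 by (auto simp: arcs_ends_conv)
  then have "awalk v (a # p) (last (w # vs))" using p(1) by (simp add: awalk_Cons_iff)
  then show ?case using a p by (intro exI[of _ "a # p"]) auto
qed simp

lemma (in graph) girth_le_cycle_length:
  assumes "3 \<le> length ws" "distinct ws" "set ws \<subseteq> verts G"
    and "successively (\<lambda>x y. (x, y) \<in> arcs_ends G) ws" "(last ws, hd ws) \<in> arcs_ends G"
  shows "girth G \<le> enat (length ws)"
proof -
  have ne: "ws \<noteq> []" using assms(1) by auto
  let ?vs = "ws @ [hd ws]"
  have "hd ws \<in> verts G" using hd_in_set[OF ne] assms(3) by blast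
  moreover have "successively (\<lambda>x y. (x, y) \<in> arcs_ends G) ?vs"
    using assms(4,5) by (simp add: successively_append_iff)
  ultimately obtain p where p: "awalk (hd ws) p (hd ws)" "awalk_verts (hd ws) p = ?vs"
    using walk_through[of ?vs] assms(3) ne by auto
  have len: "length p = length ws" using length_awalk_verts[of "hd ws" p] p(2) by simp
  have "distinct (tl ?vs)" using assms(2) ne by (cases ws) auto
  then have "cycle p" unfolding cycle_def using p len ne by auto
  then show ?thesis unfolding girth_def using len assms(1) by (intro INF_lower2[of p]) auto
qed

section \<open>Planar graphs of girth at least 7\<close>

lemma (in graph) plane_subgraph:
  assumes "plane_drawing G pos crv" "X \<subseteq> verts G"
  shows "plane_graph X {e \<in> edges G. e \<subseteq> X} pos crv"
proof
  note D = assms(1)[unfolded plane_drawing_def]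
  note D_edge = D[THEN conjunct2, THEN conjunct1, THEN bspec]
    and D_edges = D[THEN conjunct2, THEN conjunct2, THEN bspec, THEN bspec, THEN mp]
  show "finite X" using assms(2) finite_verts finite_subset by blast
  show "inj_on pos X" using inj_on_subset[OF D[THEN conjunct1] assms(2)] .
  show "graph_edges X {e \<in> edges G. e \<subseteq> X}"
    unfolding graph_edges_def
  proof
    fix e assume "e \<in> {e \<in> edges G. e \<subseteq> X}"
    then obtain u v where uv: "e = {u, v}" "(u, v) \<in> arcs_ends G" "e \<subseteq> X" by (auto simp: edges_def)
    then have "u \<noteq> v" using adj_props(2) by blast
    then show "\<exists>u v. u \<in> X \<and> v \<in> X \<and> u \<noteq> v \<and> e = {u, v}" using uv by auto
  qed
  fix e assume e: "e \<in> {e \<in> edges G. e \<subseteq> X}"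
  then have eG: "e \<in> edges G" by simp
  show "Path_Connected.arc (crv e)" "{pathstart (crv e), pathfinish (crv e)} = pos ` e"
    using D_edge[OF eG] by simp_all
  have "pos ` e \<subseteq> pos ` X" "pos ` X \<subseteq> pos ` verts G" using e assms(2) by blast+
  moreover have "path_image (crv e) \<inter> pos ` verts G = pos ` e" using D_edge[OF eG] by simp
  ultimately show "path_image (crv e) \<inter> pos ` X = pos ` e" by blast
  fix f assume "f \<in> {e \<in> edges G. e \<subseteq> X}" "e \<noteq> f"
  then show "path_image (crv e) \<inter> path_image (crv f) = pos ` (e \<inter> f)"
    using D_edges[OF eG] by simp
qed

lemma (in graph) degree_sum_le:
  assumes "X \<subseteq> verts G"
  shows "(\<Sum>v\<in>X. card {u \<in> X. (v, u) \<in> arcs_ends G}) \<le> 2 * card {e \<in> edges G. e \<subseteq> X}"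
proof -
  let ?E = "{e \<in> edges G. e \<subseteq> X}"
  have finX: "finite X" using assms finite_verts finite_subset by blast
  have finE: "finite ?E" using finX by (intro finite_subset[of ?E "Pow X"]) auto
  have pairs: "card {(u, v). {u, v} = e} \<le> 2 \<and> finite {(u, v). {u, v} = e}" if e: "e \<in> ?E" for e
  proof -
    obtain a b where "e = {a, b}" using e by (auto simp: edges_def)
    then have sub: "{(u, v). {u, v} = e} \<subseteq> {(a, b), (b, a)}" by (auto simp: doubleton_eq_iff)
    have "card {(u, v). {u, v} = e} \<le> card {(a, b), (b, a)}" using sub by (rule card_mono[rotated]) simp
    also have "\<dots> \<le> 2" using card_insert_le_m1[of 2 "{(b, a)}" "(a, b)"] by simp
    finally show ?thesis using finite_subset[OF sub] by simp
  qed
  have "(\<Sum>v\<in>X. card {u \<in> X. (v, u) \<in> arcs_ends G}) = card (SIGMA v:X. {u \<in> X. (v, u) \<in> arcs_ends G})"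
    using finX by (simp add: card_SigmaI)
  also have "\<dots> \<le> card (\<Union>e\<in>?E. {(u, v). {u, v} = e})"
  proof (rule card_mono)
    show "finite (\<Union>e\<in>?E. {(u, v). {u, v} = e})" using finE pairs by blast
    show "(SIGMA v:X. {u \<in> X. (v, u) \<in> arcs_ends G}) \<subseteq> (\<Union>e\<in>?E. {(u, v). {u, v} = e})"
    proof
      fix z assume "z \<in> (SIGMA v:X. {u \<in> X. (v, u) \<in> arcs_ends G})"
      then obtain v u where z: "z = (v, u)" "v \<in> X" "u \<in> X" "(v, u) \<in> arcs_ends G" by blast
      then have "{v, u} \<in> edges G" unfolding edges_def by (metis (mono_tags, lifting) case_prod_conv image_eqI)
      then have "{v, u} \<in> ?E" using z by blast
      then show "z \<in> (\<Union>e\<in>?E. {(u, v). {u, v} = e})" using z(1) by blast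
    qed
  qed
  also have "\<dots> \<le> (\<Sum>e\<in>?E. card {(u, v). {u, v} = e})" using finE by (rule card_UN_le)
  also have "\<dots> \<le> (\<Sum>e\<in>?E. 2)" using pairs by (intro sum_mono) blast
  finally show ?thesis by simp
qed

lemma (in graph) sparse_subgraphs:
  assumes "planar G" "girth G \<ge> 7" "X \<subseteq> verts G" "X \<noteq> {}"
  shows "5 * (\<Sum>v\<in>X. card {u \<in> X. (v, u) \<in> arcs_ends G}) < 14 * card X"
proof -
  let ?E = "{e \<in> edges G. e \<subseteq> X}"
  obtain pos crv where "plane_drawing G pos crv" using assms(1) by (auto simp: planar_def)
  then interpret P: plane_graph X ?E pos crv using assms(3) by (rule plane_subgraph)
  have adjE: "(u, v) \<in> arcs_ends G" if "{u, v} \<in> edges G" for u v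
    using that adj_props(1) by (auto simp: edges_def doubleton_eq_iff)
  have "(7 - 2) * card ?E + 7 \<le> 7 * card X"
  proof (rule P.girth_edge_bound[OF assms(4)])
    fix ws assume ws: "cycle_verts ?E ws"
    then have "3 \<le> length ws" "distinct ws" "successively (\<lambda>x y. {x, y} \<in> ?E) ws" "{last ws, hd ws} \<in> ?E"
      by (auto simp: cycle_verts_def)
    moreover from this have "successively (\<lambda>x y. (x, y) \<in> arcs_ends G) ws" "(last ws, hd ws) \<in> arcs_ends G"
      using adjE by (auto elim: successively_mono)
    moreover have "set ws \<subseteq> verts G"
    proof
      fix z assume "z \<in> set ws"
      then obtain i where i: "i < length ws" "z = ws ! i" by (auto simp: in_set_conv_nth)
      have "\<exists>y. {y, z} \<in> ?E"
      proof (cases "Suc i < length ws")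
        case True
        then have "{ws ! i, ws ! Suc i} \<in> ?E"
          using calculation(3) by (simp add: successively_conv_nth)
        then show ?thesis using i by (metis insert_commute)
      next
        case False
        then have "i = length ws - 1" "ws \<noteq> []" using i(1) by auto
        then have "z = last ws" using i(2) by (simp add: last_conv_nth)
        then show ?thesis using calculation(4) by (metis insert_commute)
      qed
      then show "z \<in> verts G" using assms(3) by blast
    qed
    ultimately have "girth G \<le> enat (length ws)" by (intro girth_le_cycle_length)
    then have "enat 7 \<le> enat (length ws)" using assms(2) by (metis numeral_eq_enat order_trans)
    then show "7 \<le> length ws" by simp
  qed simp
  then have "5 * card ?E + 7 \<le> 7 * card X" by simp
  then show ?thesis using degree_sum_le[OF assms(3)] by linarith
qed

text \<open>
  The induction over vertex subsets supplies the minimality that \<open>critical_graph\<close> requires.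
\<close>
lemma (in graph) colour_subgraphs:
  assumes "planar G" "girth G \<ge> 7" "max_degree G \<ge> 10" "X \<subseteq> verts G"
  shows "\<exists>\<phi>. proper_colouring (\<lambda>u v. (u, v) \<in> arcs_ends G) {1..max_degree G + 2} X \<phi>"
proof -
  let ?adj = "\<lambda>u v. (u, v) \<in> arcs_ends G" and ?K = "{1..max_degree G + 2}"
  have "finite X" using assms(4) finite_verts finite_subset by blast
  then show ?thesis using assms(4)
  proof (induction X rule: finite_psubset_induct)
    case (psubset X)
    show ?case
    proof (rule ccontr)
      assume bad: "\<not> ?case"
      interpret critical_graph ?adj X ?K "max_degree G"
      proof
        show "(u, v) \<in> arcs_ends G \<Longrightarrow> (v, u) \<in> arcs_ends G" for u v by (rule adj_props(1))
        show "(v, v) \<notin> arcs_ends G" for v by (rule adj_props(2))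
        show "7 \<le> length ws" if "3 \<le> length ws" "distinct ws" "set ws \<subseteq> X" "successively ?adj ws"
          "(last ws, hd ws) \<in> arcs_ends G" for ws
        proof -
          have "girth G \<le> enat (length ws)"
            using that psubset.prems by (intro girth_le_cycle_length) auto
          then have "enat 7 \<le> enat (length ws)" using assms(2) by (metis numeral_eq_enat order_trans)
          then show ?thesis by simp
        qed
        show "finite X" by fact
        show "card {u \<in> X. (v, u) \<in> arcs_ends G} \<le> max_degree G" if "v \<in> X" for v
        proof -
          have "card {u \<in> X. (v, u) \<in> arcs_ends G} \<le> card {u \<in> verts G. (v, u) \<in> arcs_ends G}"
            using psubset.prems by (intro card_mono) auto
          also have "\<dots> \<le> max_degree G" using degree_le_max_degree that psubset.prems by blast
          finally show ?thesis .
        qed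
        show "10 \<le> max_degree G" by (rule assms(3))
        show "card ?K = max_degree G + 2" by simp
        show "\<not> proper_colouring ?adj ?K X \<phi>" for \<phi> using bad by blast
        show "\<exists>\<phi>. proper_colouring ?adj ?K Y \<phi>" if "Y \<subset> X" for Y
          using psubset.IH[OF that] that psubset.prems by blast
      qed
      have "X \<noteq> {}"
      proof
        assume "X = {}"
        then have "proper_colouring ?adj ?K X (\<lambda>_. 1)" by (simp add: proper_colouring_def)
        then show False using bad by blast
      qed
      then show False
        using sparse_subgraphs[OF assms(1,2) psubset.prems] critical_degree_sum by (simp add: d_def N_def)
    qed
  qed
qed

theorem corollary6:
  fixes G :: "('a, 'b) pre_digraph"
  assumes "graph G"
    and "planar G"
    and "girth G \<ge> 7"
    and "max_degree G \<ge> 10"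
  shows "\<exists>\<phi>. two_distance_coloring G (max_degree G + 2) \<phi>"
proof -
  interpret graph G by (rule assms(1))
  obtain \<phi> where \<phi>: "proper_colouring (\<lambda>u v. (u, v) \<in> arcs_ends G) {1..max_degree G + 2} (verts G) \<phi>"
    using colour_subgraphs[OF assms(2-4) order_refl] by blast
  have "two_distance_coloring G (max_degree G + 2) \<phi>"
    unfolding two_distance_coloring_def
  proof (intro conjI ballI impI)
    show "\<phi> ` verts G \<subseteq> {1..max_degree G + 2}" using \<phi> by (simp add: proper_colouring_def)
    fix x y assume xy: "x \<in> verts G" "y \<in> verts G" "x \<noteq> y \<and> graph_distance G x y \<le> 2"
    then have "(x, y) \<in> arcs_ends G \<or> (\<exists>z\<in>verts G. (x, z) \<in> arcs_ends G \<and> (z, y) \<in> arcs_ends G)"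
      using distance_two by blast
    then show "\<phi> x \<noteq> \<phi> y" using \<phi> xy unfolding proper_colouring_def by blast
  qed
  then show ?thesis by blast
qed

end
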